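(* Let $K_n=(V_n,E_n)$ be the complete graph on $n$ vertices, let $(\omega_e)_{e\in E_n}$ be i.i.d. uniform on $[0,1]$ with law $\mathbb{P}$, and let $\beta=\beta(n)\ge0$. Let $\mathcal{O}(\beta)$ be the expected edge overlap of two independent RSTREs in the same environment. If $0<\beta=\beta(n)\ll n/\log n$, then with high $\mathbb{P}$-probability $$\mathcal{O}(\beta)=(1+o(1))\,\beta\,\frac{1-e^{-2\beta}}{(1-e^{-\beta})^2}.$$ If on the other hand $\beta\gg n(\log n)^2$, then with high $\mathbb{P}$-probability $$\mathcal{O}(\beta)=(1-o(1))\,n.$$
   Context: Given $\omega$ and $\beta$, the random spanning tree in random environment (RSTRE) is the random spanning tree $\mathcal{T}$ of $K_n$ with law $\mathbf{P}^\omega_{n,\beta}(\mathcal{T}=T)\propto\prod_{e\in T}e^{-\beta\omega_e}$ over all spanning trees $T$ of $K_n$. The expected overlap is $\mathcal{O}(\beta)=\sum_{T,T'}|T\cap T'|\,\mathbf{P}^\omega_{n,\beta}(\mathcal{T}=T)\mathbf{P}^\omega_{n,\beta}(\mathcal{T}=T')=\sum_{e\in E_n}\mathbf{P}^\omega_{n,\beta}(e\in\mathcal{T})^2$, a function of the random environment $\omega$, where $|T\cap T'|$ is the number of common edges. $f\ll g$ (equivalently $g\gg f$) means $f(n)/g(n)\to0$ as $n\to\infty$. "With high probability" means with probability tending to $1$ as $n\to\infty$; a statement "$X_n=(1+o(1))a_n$ with high probability" means that for some deterministic $\delta_n\to0$, $|X_n/a_n-1|\le\delta_n$ with probability tending to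 1. *)

theory Defs
  imports "HOL-Probability.Probability" "HOL-Library.Landau_Symbols"
begin

text \<open>The complete graph on the vertex set \<open>{..<n}\<close>. An undirected edge is a two-element set of
  vertices, and a subgraph on all vertices is identified with its set of edges.\<close>

definition complete_edges :: "nat \<Rightarrow> nat set set" where
  "complete_edges n = {e. e \<subseteq> {..<n} \<and> card e = 2}"

definition connected_graph :: "'a set \<Rightarrow> 'a set set \<Rightarrow> bool" where
  "connected_graph V T \<longleftrightarrow> (\<forall>u\<in>V. \<forall>v\<in>V. (u, v) \<in> {(x, y). {x, y} \<in> T}\<^sup>*)"

text \<open>The vertices of a cycle are listed without repeating the first one at the end; the closing
  edge is the one with index \<open>i = length p - 1\<close>.\<close>

definition graph_cycle :: "'a set set \<Rightarrow> 'a list \<Rightarrow> bool" where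
  "graph_cycle T p \<longleftrightarrow> length p \<ge> 3 \<and> distinct p \<and>
     (\<forall>i<length p. {p ! i, p ! (Suc i mod length p)} \<in> T)"

definition spanning_trees :: "nat \<Rightarrow> nat set set set" where
  "spanning_trees n =
     {T. T \<subseteq> complete_edges n \<and> connected_graph {..<n} T \<and> (\<nexists>p. graph_cycle T p)}"

definition env_measure :: "nat \<Rightarrow> (nat set \<Rightarrow> real) measure" where
  "env_measure n = (\<Pi>\<^sub>M e\<in>complete_edges n. uniform_measure lborel {0..1})"

definition tree_weight :: "real \<Rightarrow> (nat set \<Rightarrow> real) \<Rightarrow> nat set set \<Rightarrow> real" where
  "tree_weight b \<omega> T = (\<Prod>e\<in>T. exp (- b * \<omega> e))"

text \<open>The probability mass function of the random spanning tree at inverse temperature \<open>b\<close> in the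
  environment \<open>\<omega>\<close>.\<close>

definition rstre_prob :: "nat \<Rightarrow> real \<Rightarrow> (nat set \<Rightarrow> real) \<Rightarrow> nat set set \<Rightarrow> real" where
  "rstre_prob n b \<omega> T =
     (if T \<in> spanning_trees n
      then tree_weight b \<omega> T / (\<Sum>T'\<in>spanning_trees n. tree_weight b \<omega> T') else 0)"

definition expected_overlap :: "nat \<Rightarrow> real \<Rightarrow> (nat set \<Rightarrow> real) \<Rightarrow> real" where
  "expected_overlap n b \<omega> =
     (\<Sum>T\<in>spanning_trees n. \<Sum>T'\<in>spanning_trees n.
        real (card (T \<inter> T')) * rstre_prob n b \<omega> T * rstre_prob n b \<omega> T')"

definition whp :: "(nat \<Rightarrow> (nat set \<Rightarrow> real) \<Rightarrow> bool) \<Rightarrow> bool" where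
  "whp P \<longleftrightarrow>
     (\<lambda>n. measure (env_measure n) {\<omega> \<in> space (env_measure n). P n \<omega>}) \<longlonglongrightarrow> 1"

text \<open>\<open>X\<^sub>n = (1 + o(1)) a\<^sub>n\<close> with high probability, the error term being bounded by a deterministic
  null sequence. Since the sign of the error is unconstrained, this also expresses
  \<open>X\<^sub>n = (1 - o(1)) a\<^sub>n\<close>.\<close>

definition whp_asymp :: "(nat \<Rightarrow> (nat set \<Rightarrow> real) \<Rightarrow> real) \<Rightarrow> (nat \<Rightarrow> real) \<Rightarrow> bool" where
  "whp_asymp X a \<longleftrightarrow>
     (\<exists>\<delta> :: nat \<Rightarrow> real. \<delta> \<longlonglongrightarrow> 0 \<and> whp (\<lambda>n \<omega>. \<bar>X n \<omega> / a n - 1\<bar> \<le> \<delta> n))"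

text \<open>The events in \<open>whp_asymp\<close> are measurable for the overlap, so that their measures are genuine
  probabilities.\<close>

lemma finite_complete_edges: "finite (complete_edges n)"
  unfolding complete_edges_def by simp

lemma finite_spanning_trees: "finite (spanning_trees n)"
proof (rule finite_subset)
  show "spanning_trees n \<subseteq> Pow (complete_edges n)"
    unfolding spanning_trees_def by auto
qed (simp add: finite_complete_edges)

lemma prob_space_env_measure: "prob_space (env_measure n)"
  unfolding env_measure_def
  by (intro prob_space_PiM prob_space_uniform_measure) auto

lemma measurable_env_component [measurable]:
  assumes "e \<in> complete_edges n"
  shows "(\<lambda>\<omega>. \<omega> e) \<in> borel_measurable (env_measure n)"
proof -
  have "(\<lambda>\<omega>. \<omega> e) \<in> env_measure n \<rightarrow>\<^sub>M uniform_measure lborel {0..1}"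
    unfolding env_measure_def using assms by (rule measurable_component_singleton)
  then show ?thesis
    by (simp cong: measurable_cong_sets)
qed

lemma measurable_tree_weight:
  assumes "T \<in> spanning_trees n"
  shows "(\<lambda>\<omega>. tree_weight b \<omega> T) \<in> borel_measurable (env_measure n)"
  unfolding tree_weight_def
proof (rule borel_measurable_prod)
  fix e assume "e \<in> T"
  then have [measurable]: "(\<lambda>\<omega>. \<omega> e) \<in> borel_measurable (env_measure n)"
    using assms by (intro measurable_env_component) (auto simp: spanning_trees_def)
  show "(\<lambda>\<omega>. exp (- b * \<omega> e)) \<in> borel_measurable (env_measure n)"
    by measurable
qed

lemma measurable_expected_overlap:
  "(\<lambda>\<omega>. expected_overlap n b \<omega>) \<in> borel_measurable (env_measure n)"
  unfolding expected_overlap_def rstre_prob_def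
  by (intro borel_measurable_sum borel_measurable_times borel_measurable_const
      borel_measurable_divide measurable_If measurable_tree_weight) auto

end

theory Submission
  imports Defs "HOL-Real_Asymp.Real_Asymp"
begin

text \<open>The overlap is the sum over all edges \<open>e\<close> of \<open>p e ^ 2\<close>, where \<open>p e\<close> is the probability that the tree
  contains \<open>e\<close>. Kirchhoff's formula says that \<open>p e\<close> is the conductance \<open>exp (- \<beta> * \<omega> e)\<close> times the effective
  resistance between the ends of \<open>e\<close>; it is proved combinatorially, by writing the potential of a unit
  current as a ratio of weights of two-component forests and trees (\<open>forest_potential_laplacian\<close>). The
  probabilities \<open>p e\<close> add up to \<open>n - 1\<close>, the number of edges of a tree. Both regimes follow from these
  two facts and from bounds on resistances.

  For weak disorder let \<open>\<mu>\<close> and \<open>\<mu>2\<close> be the means of a conductance and of its square. The mean degree is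
  about \<open>n * \<mu>\<close>, which is at least of order \<open>n / (1 + \<beta>)\<close> and so much larger than \<open>ln n\<close>. Hence Chernoff
  bounds survive union bounds over vertices and even over all cuts. One expects every resistance to be about \<open>2 / (n * \<mu>)\<close>, with the two stars around the ends of an edge connected in
  series, and the sum of squares to be \<open>(2 / (n * \<mu>)) ^ 2 * (n ^ 2 / 2) * \<mu>2\<close>, which is the asserted
  formula. The lower bound on resistances is immediate from the degrees. A sharp upper bound for each
  edge would need spectral information, but it can be avoided: as the \<open>p e\<close> add up to \<open>n - 1\<close>, the lower
  bounds are almost attained on average. The edges for which this fails are harmless as soon as all
  resistances are \<open>O(1 / (n * \<mu>))\<close>, and this follows from the expansion of cuts by Cheeger's inequality
  (\<open>sum_squares_edge_prob_near_uniform\<close>).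

  For strong disorder choose a slack \<open>\<delta>\<close> of order \<open>ln n / \<beta>\<close>. If the ends of \<open>e\<close> are joined by edges
  lighter than \<open>\<omega> e - \<delta>\<close>, then these short-circuit \<open>e\<close> and \<open>p e\<close> is polynomially small. So the total
  probability \<open>n - 1\<close> sits on the remaining edges. Those whose ends are not even joined by edges of
  weight at most \<open>\<omega> e\<close> form a forest. For each of the others, \<open>\<omega> e\<close> is confined, given all the other
  coordinates, to an interval of length \<open>\<delta>\<close>; the expected number of these is \<open>O(n ^ 2 * \<delta>)\<close>, which is
  \<open>o(n)\<close>. The mass \<open>n - 1\<close> on \<open>(1 + o(1)) * n\<close> edges, each of probability at most one, leaves no choice
  but that the sum of squares is \<open>(1 - o(1)) * n\<close> (\<open>overlap_near_n\<close>).\<close>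

section \<open>Connectivity and spanning trees\<close>

text \<open>Reachability through edges of \<open>F\<close>. Unlike \<open>connected_graph\<close> it refers to a single pair of
  vertices, so that components of forests can be compared.\<close>

definition linked :: "'a set set \<Rightarrow> 'a \<Rightarrow> 'a \<Rightarrow> bool" where
  "linked F a b \<longleftrightarrow> (a, b) \<in> {(x, y). {x, y} \<in> F}\<^sup>*"

lemma linked_refl [simp]: "linked F a a"
  by (simp add: linked_def)

lemma linked_trans: "linked F a b \<Longrightarrow> linked F b c \<Longrightarrow> linked F a c"
  unfolding linked_def by (rule rtrancl_trans)

lemma linked_sym: "linked F a b \<Longrightarrow> linked F b a"
  unfolding linked_def
  by (rule symD[OF sym_rtrancl]) (auto simp: sym_def insert_commute)

lemma linked_edge: "{a, b} \<in> F \<Longrightarrow> linked F a b"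
  unfolding linked_def by (auto intro: r_into_rtrancl)

lemma linked_mono: "linked F a b \<Longrightarrow> F \<subseteq> G \<Longrightarrow> linked G a b"
  unfolding linked_def by (erule rtrancl_mono[THEN subsetD, rotated]) auto

lemma linked_induct [consumes 1, case_names refl step]:
  assumes "linked F a b" "P a"
    and "\<And>y z. linked F a y \<Longrightarrow> {y, z} \<in> F \<Longrightarrow> P y \<Longrightarrow> P z"
  shows "P b"
  using assms(1) unfolding linked_def
  by (induction rule: rtrancl_induct) (use assms in \<open>auto simp: linked_def\<close>)

lemma linked_leaves:
  assumes "linked F a b" "a \<in> S" "b \<notin> S"
  obtains x y where "linked F a x" "x \<in> S" "y \<notin> S" "{x, y} \<in> F"
proof -
  have "b \<in> S \<or> (\<exists>x y. linked F a x \<and> x \<in> S \<and> y \<notin> S \<and> {x, y} \<in> F)"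
    using assms(1) by (induction rule: linked_induct) (use assms(2) in auto)
  with assms(3) that show ?thesis by blast
qed

lemma connected_graph_iff_linked: "connected_graph V T \<longleftrightarrow> (\<forall>u\<in>V. \<forall>v\<in>V. linked T u v)"
  by (simp add: connected_graph_def linked_def)

text \<open>A walk starting in \<open>x\<close> can be cut at its last passage through the edge \<open>{x, y}\<close>; what remains
  starts in \<open>x\<close> or in \<open>y\<close> and avoids that edge.\<close>

lemma linked_delete_edge:
  assumes "linked F x z"
  shows "linked (F - {{x, y}}) x z \<or> linked (F - {{x, y}}) y z"
  using assms
proof (induction rule: linked_induct)
  case (step z z')
  show ?case
  proof (cases "{z, z'} = {x, y}")
    case True
    then show ?thesis by (auto simp: doubleton_eq_iff)
  next
    case False
    with step have "linked (F - {{x, y}}) z z'" by (intro linked_edge) auto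
    with step show ?thesis by (blast intro: linked_trans)
  qed
qed simp

text \<open>Grow a connected vertex set one vertex at a time: as long as it is not all of \<open>V\<close>, connectedness
  provides an edge leaving it. This is the only source of spanning trees and of lower bounds on the
  number of edges of a connected graph.\<close>

lemma connected_graph_contains_small:
  assumes "finite V" "V \<noteq> {}" "connected_graph V T" "\<And>e. e \<in> T \<Longrightarrow> e \<subseteq> V"
  obtains P where "P \<subseteq> T" "connected_graph V P" "card P = card V - 1"
proof -
  have grow: "\<exists>A P. A \<subseteq> V \<and> P \<subseteq> T \<and> card A = Suc k \<and> card P = k \<and> finite P \<and>
      connected_graph A P \<and> \<Union>P \<subseteq> A" if "k < card V" for k
    using that
  proof (induction k)
    case 0
    from assms(2) obtain a where "a \<in> V" by blast
    then show ?case
      by (intro exI[of _ "{a}"] exI[of _ "{}"]) (auto simp: connected_graph_iff_linked)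
  next
    case (Suc k)
    then obtain A P where AP: "A \<subseteq> V" "P \<subseteq> T" "card A = Suc k" "card P = k" "finite P"
      "connected_graph A P" "\<Union>P \<subseteq> A" by auto
    have fA: "finite A" using AP(1) assms(1) finite_subset by blast
    have "A \<noteq> V" using AP(3) Suc.prems by auto
    then obtain b where b: "b \<in> V" "b \<notin> A" using AP(1) by blast
    obtain a where a: "a \<in> A" using AP(3) by (metis card.empty equals0I nat.distinct(1))
    have "linked T a b" using assms(3) a b AP(1) by (auto simp: connected_graph_iff_linked)
    from linked_leaves[OF this a b(2)]
    obtain x y where xy: "x \<in> A" "y \<notin> A" "{x, y} \<in> T" by metis
    have "y \<in> V" using assms(4)[OF xy(3)] by auto
    have new: "{x, y} \<notin> P" using AP(7) xy(2) by auto
    have lx: "linked (insert {x, y} P) a x" if "a \<in> insert y A" for a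
    proof (cases "a = y")
      case True
      then show ?thesis by (auto intro!: linked_edge simp: insert_commute)
    next
      case False
      with that have "linked P a x" using AP(6) xy(1) by (auto simp: connected_graph_iff_linked)
      then show ?thesis by (rule linked_mono) auto
    qed
    have "connected_graph (insert y A) (insert {x, y} P)"
      unfolding connected_graph_iff_linked using lx by (metis linked_sym linked_trans)
    then show ?case
      using AP xy \<open>y \<in> V\<close> new fA
      by (intro exI[of _ "insert y A"] exI[of _ "insert {x, y} P"]) auto
  qed
  have "card V > 0" using assms(1,2) by (simp add: card_gt_0_iff)
  with grow[of "card V - 1"] obtain A P where AP: "A \<subseteq> V" "P \<subseteq> T" "card A = card V"
    "card P = card V - 1" "connected_graph A P" by auto
  then have "A = V" using assms(1) by (simp add: card_subset_eq)
  with AP that show ?thesis by blast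
qed

lemma linked_simple_path:
  assumes "linked F a b"
  obtains p where "p \<noteq> []" "distinct p" "hd p = a" "last p = b"
    "\<And>i. Suc i < length p \<Longrightarrow> {p ! i, p ! Suc i} \<in> F"
proof -
  have "\<exists>p. p \<noteq> [] \<and> distinct p \<and> hd p = a \<and> last p = b \<and>
      (\<forall>i. Suc i < length p \<longrightarrow> {p ! i, p ! Suc i} \<in> F)"
    using assms
  proof (induction rule: linked_induct)
    case refl
    show ?case by (intro exI[of _ "[a]"]) auto
  next
    case (step y z)
    then obtain p where p: "p \<noteq> []" "distinct p" "hd p = a" "last p = y"
      "\<And>i. Suc i < length p \<Longrightarrow> {p ! i, p ! Suc i} \<in> F" by auto
    show ?case
    proof (cases "z \<in> set p")
      case True
      then obtain j where j: "j < length p" "p ! j = z" by (auto simp: in_set_conv_nth)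
      have "last (take (Suc j) p) = z"
        using j by (simp add: take_Suc_conv_app_nth)
      then show ?thesis using p j
        by (intro exI[of _ "take (Suc j) p"]) (auto simp: hd_take)
    next
      case False
      have "{(p @ [z]) ! i, (p @ [z]) ! Suc i} \<in> F" if "Suc i < length (p @ [z])" for i
      proof (cases "Suc i < length p")
        case True
        then show ?thesis using p(5) by (simp add: nth_append)
      next
        case False
        with that have "i = length p - 1" "Suc i = length p" by auto
        then have "(p @ [z]) ! i = y" "(p @ [z]) ! Suc i = z"
          using p(1,4) by (auto simp: nth_append last_conv_nth)
        then show ?thesis using step by simp
      qed
      then show ?thesis using p False by (intro exI[of _ "p @ [z]"]) auto
    qed
  qed
  then show ?thesis using that by blast
qed

lemma complete_edgeE:
  assumes "e \<in> complete_edges n"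
  obtains x y where "e = {x, y}" "x \<noteq> y" "x < n" "y < n"
  using assms that by (auto simp: complete_edges_def card_2_iff)

lemma doubleton_in_complete_edges: "{x, y} \<in> complete_edges n \<longleftrightarrow> x \<noteq> y \<and> x < n \<and> y < n"
  by (auto simp: complete_edges_def card_2_iff doubleton_eq_iff)

lemma connected_card_ge:
  assumes "T \<subseteq> complete_edges n" "connected_graph {..<n} T"
  shows "n - 1 \<le> card T"
proof (cases "n = 0")
  case False
  obtain P where "P \<subseteq> T" "card P = card {..<n} - 1"
    by (rule connected_graph_contains_small[of "{..<n}" T])
      (use assms False in \<open>auto simp: complete_edges_def\<close>)
  moreover have "finite T" using assms(1) finite_complete_edges finite_subset by blast
  ultimately have "card P \<le> card T" by (intro card_mono)
  with \<open>card P = card {..<n} - 1\<close> show ?thesis by simp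
qed simp

text \<open>The small connected subgraph \<open>P\<close> must be the whole tree: a further edge would close a simple path
  of \<open>P\<close> to a cycle.\<close>

lemma spanning_tree_card:
  assumes "T \<in> spanning_trees n" "n > 0"
  shows "card T = n - 1"
proof -
  from assms have T: "T \<subseteq> complete_edges n" "connected_graph {..<n} T" "\<nexists>p. graph_cycle T p"
    by (auto simp: spanning_trees_def)
  obtain P where P: "P \<subseteq> T" "connected_graph {..<n} P" "card P = card {..<n} - 1"
    by (rule connected_graph_contains_small[of "{..<n}" T])
      (use T assms(2) in \<open>auto simp: complete_edges_def\<close>)
  have "P = T"
  proof (rule ccontr)
    assume "P \<noteq> T"
    with P(1) obtain e where e: "e \<in> T" "e \<notin> P" by blast
    then obtain x y where xy: "e = {x, y}" "x \<noteq> y" "x < n" "y < n"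
      using T(1) by (blast elim: complete_edgeE)
    have "linked P x y" using P(2) xy by (auto simp: connected_graph_iff_linked)
    from linked_simple_path[OF this]
    obtain p where p: "p \<noteq> []" "distinct p" "hd p = x" "last p = y"
      "\<And>i. Suc i < length p \<Longrightarrow> {p ! i, p ! Suc i} \<in> P" by metis
    have ends: "p ! 0 = x" "p ! (length p - 1) = y"
      using p by (auto simp: hd_conv_nth last_conv_nth)
    have len: "length p \<ge> 3"
    proof (rule ccontr)
      assume "\<not> length p \<ge> 3"
      moreover have "length p > 0" using p(1) by simp
      ultimately consider "length p = 1" | "length p = 2" by linarith
      then show False
      proof cases
        case 1
        then show False using ends xy by simp
      next
        case 2
        then have "{p ! 0, p ! 1} \<in> P" using p(5)[of 0] by simp
        then show False using ends 2 e xy by simp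
      qed
    qed
    have "{p ! i, p ! (Suc i mod length p)} \<in> T" if "i < length p" for i
    proof (cases "Suc i < length p")
      case True
      then show ?thesis using p(5) P(1) by auto
    next
      case False
      with that have "Suc i = length p" by simp
      then have "i = length p - 1" "Suc i mod length p = 0" by auto
      then show ?thesis using ends e xy by (simp add: insert_commute)
    qed
    then have "graph_cycle T p" using len p by (simp add: graph_cycle_def)
    with T show False by blast
  qed
  with P show ?thesis by simp
qed

text \<open>Counting edges replaces the search for cycles: deleting an edge of a cycle keeps the graph
  connected, which is impossible with only \<open>n - 2\<close> edges left.\<close>

lemma connected_card_imp_spanning_tree:
  assumes T: "T \<subseteq> complete_edges n" "connected_graph {..<n} T" and card: "card T = n - 1"
  shows "T \<in> spanning_trees n"
proof -
  have "\<not> graph_cycle T p" for p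
  proof
    assume cyc: "graph_cycle T p"
    define l where "l = length p - 1"
    define e where "e = {p ! l, p ! 0}"
    have len: "length p \<ge> 3" and dist: "distinct p"
      and edges: "\<And>i. i < length p \<Longrightarrow> {p ! i, p ! (Suc i mod length p)} \<in> T"
      using cyc by (auto simp: graph_cycle_def)
    have "l < length p" "Suc l = length p" "p \<noteq> []" using len by (auto simp: l_def)
    then have "e \<in> T" using edges[of l] by (simp add: e_def)
    have path: "linked (T - {e}) (p ! 0) (p ! i)" if "i \<le> l" for i
      using that
    proof (induction i)
      case (Suc i)
      have "{p ! i, p ! Suc i} \<in> T" using edges[of i] Suc len by (auto simp: l_def)
      moreover have "{p ! i, p ! Suc i} \<noteq> e"
        using Suc.prems len \<open>p \<noteq> []\<close> nth_eq_iff_index_eq[OF dist, of i l]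
          nth_eq_iff_index_eq[OF dist, of i 0] nth_eq_iff_index_eq[OF dist, of "Suc i" l]
          nth_eq_iff_index_eq[OF dist, of "Suc i" 0]
        by (auto simp: e_def l_def doubleton_eq_iff)
      ultimately have "linked (T - {e}) (p ! i) (p ! Suc i)" by (intro linked_edge) auto
      with Suc show ?case by (auto intro: linked_trans)
    qed simp
    have step: "linked (T - {e}) a b" if "{a, b} \<in> T" for a b
    proof (cases "{a, b} = e")
      case True
      then show ?thesis using path[of l] by (auto simp: e_def doubleton_eq_iff intro: linked_sym)
    qed (use that in \<open>auto intro: linked_edge\<close>)
    have "linked (T - {e}) a b" if "linked T a b" for a b
      using that by (induction rule: linked_induct) (auto intro: linked_trans step)
    then have "connected_graph {..<n} (T - {e})"
      using T(2) by (auto simp: connected_graph_iff_linked)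
    then have "n - 1 \<le> card (T - {e})" using T(1) by (intro connected_card_ge) auto
    moreover have "finite T" using T(1) finite_complete_edges finite_subset by blast
    ultimately show False using \<open>e \<in> T\<close> card by (simp add: card_gt_0_iff)
  qed
  with T show ?thesis by (auto simp: spanning_trees_def)
qed

lemma spanning_treeD:
  assumes "T \<in> spanning_trees n"
  shows "T \<subseteq> complete_edges n" "connected_graph {..<n} T" "finite T"
  using assms finite_complete_edges finite_subset by (auto simp: spanning_trees_def)

lemma ex_spanning_tree:
  assumes "n > 0"
  shows "spanning_trees n \<noteq> {}"
proof -
  have "linked (complete_edges n) u v" if "u < n" "v < n" for u v
    by (cases "u = v") (use that in \<open>auto intro: linked_edge simp: doubleton_in_complete_edges\<close>)
  then have "connected_graph {..<n} (complete_edges n)"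
    by (auto simp: connected_graph_iff_linked)
  from connected_graph_contains_small[OF _ _ this]
  obtain P where "P \<subseteq> complete_edges n" "connected_graph {..<n} P" "card P = card {..<n} - 1"
    using assms by (auto simp: complete_edges_def)
  then show ?thesis using connected_card_imp_spanning_tree[of P n] by auto
qed

lemma tree_edge_vertices:
  assumes "T \<in> spanning_trees n" "{x, y} \<in> T"
  shows "x \<noteq> y" "x < n" "y < n"
  using assms spanning_treeD(1) doubleton_in_complete_edges by blast+

lemma tree_edge_separates:
  assumes T: "T \<in> spanning_trees n" and e: "{x, y} \<in> T"
  shows "\<not> linked (T - {{x, y}}) x y"
proof
  assume l: "linked (T - {{x, y}}) x y"
  note xy = tree_edge_vertices[OF T e]
  have "linked (T - {{x, y}}) x z" if "z < n" for z
  proof -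
    have "linked T x z" using spanning_treeD(2)[OF T] xy that
      by (auto simp: connected_graph_iff_linked)
    then show ?thesis using linked_delete_edge[of T x z y] l by (auto intro: linked_trans)
  qed
  then have "connected_graph {..<n} (T - {{x, y}})"
    unfolding connected_graph_iff_linked lessThan_iff Ball_def by (metis linked_sym linked_trans)
  then have "n - 1 \<le> card (T - {{x, y}})"
    using spanning_treeD(1)[OF T] by (intro connected_card_ge) auto
  moreover have "card (T - {{x, y}}) = n - 1 - 1"
    using spanning_tree_card[OF T] e xy by simp
  ultimately show False using xy by linarith
qed

lemma tree_edge_sides:
  assumes T: "T \<in> spanning_trees n" and e: "{x, y} \<in> T" and z: "z < n"
  shows "linked (T - {{x, y}}) y z \<longleftrightarrow> \<not> linked (T - {{x, y}}) x z"
proof -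
  note xy = tree_edge_vertices[OF T e]
  have "linked T x z" using spanning_treeD(2)[OF T] xy z
    by (auto simp: connected_graph_iff_linked)
  then have "linked (T - {{x, y}}) x z \<or> linked (T - {{x, y}}) y z"
    by (rule linked_delete_edge)
  then show ?thesis using tree_edge_separates[OF T e] by (metis linked_sym linked_trans)
qed

text \<open>The branches of a tree at \<open>x\<close>, obtained by deleting one edge at \<open>x\<close> each, partition the other
  vertices. Two branches cannot overlap, because a walk leaving the branch of \<open>y1\<close> has to use the
  edge \<open>{x, y1}\<close> and thus passes through \<open>x\<close>.\<close>

lemma tree_unique_branch:
  assumes T: "T \<in> spanning_trees n" and x: "x < n" and v: "v < n" "v \<noteq> x"
  shows "\<exists>!y. {x, y} \<in> T \<and> linked (T - {{x, y}}) y v"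
proof -
  have "linked T x v" using spanning_treeD(2)[OF T] x v
    by (auto simp: connected_graph_iff_linked)
  then have "v = x \<or> (\<exists>y. {x, y} \<in> T \<and> linked (T - {{x, y}}) y v)"
  proof (induction rule: linked_induct)
    case (step v v')
    show ?case
    proof (cases "v = x \<or> v' = x")
      case True
      then show ?thesis using step by auto
    next
      case False
      with step obtain y where y: "{x, y} \<in> T" "linked (T - {{x, y}}) y v" by blast
      have "linked (T - {{x, y}}) v v'"
        using False step by (intro linked_edge) (auto simp: doubleton_eq_iff)
      with y show ?thesis by (blast intro: linked_trans)
    qed
  qed simp
  moreover have "y1 = y2"
    if y1: "{x, y1} \<in> T" "linked (T - {{x, y1}}) y1 v"
      and y2: "{x, y2} \<in> T" "linked (T - {{x, y2}}) y2 v" for y1 y2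
  proof (rule ccontr)
    assume ne: "y1 \<noteq> y2"
    \<comment> \<open>the branch behind \<open>y1\<close>\<close>
    define B where "B = {z. linked (T - {{x, y1}}) y1 z}"
    have xB: "x \<notin> B" using tree_edge_separates[OF T y1(1)] linked_sym[of _ y1 x] by (auto simp: B_def)
    have "linked (T - {{x, y1}}) x y2"
      using y2 ne by (intro linked_edge) (auto simp: doubleton_eq_iff)
    then have y2B: "y2 \<notin> B" using xB by (unfold B_def mem_Collect_eq) (metis linked_sym linked_trans)
    have "v \<in> B" using y1 by (simp add: B_def)
    from linked_leaves[OF linked_sym[OF y2(2)] this y2B]
    obtain a b where ab: "linked (T - {{x, y2}}) v a" "a \<in> B" "b \<notin> B" "{a, b} \<in> T - {{x, y2}}"
      by metis
    have "{a, b} = {x, y1}"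
    proof (rule ccontr)
      assume "{a, b} \<noteq> {x, y1}"
      then have "linked (T - {{x, y1}}) a b" using ab by (intro linked_edge) auto
      then show False using ab by (auto simp: B_def intro: linked_trans)
    qed
    then have "b = x" using ab xB by (auto simp: doubleton_eq_iff)
    then have "linked (T - {{x, y2}}) v x" using ab by (blast intro: linked_trans linked_edge)
    then show False using tree_edge_separates[OF T y2(1)] y2(2) by (metis linked_sym linked_trans)
  qed
  ultimately show ?thesis using v(2) by metis
qed

section \<open>Two-component forests and Kirchhoff's node law\<close>

text \<open>Spanning forests with exactly two components, presented as trees with one edge deleted.\<close>

definition two_forests :: "nat \<Rightarrow> nat set set set" where
  "two_forests n = {T - {e} | T e. T \<in> spanning_trees n \<and> e \<in> T}"

lemma finite_two_forests: "finite (two_forests n)"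
proof (rule finite_subset)
  show "two_forests n \<subseteq> Pow (complete_edges n)"
    unfolding two_forests_def by (auto dest: spanning_treeD(1))
qed (simp add: finite_complete_edges)

text \<open>Deleting a tree edge and inserting an edge between the two components are mutually inverse; this
  exchange underlies all the reindexings of sums below.\<close>

lemma two_forest_join:
  assumes F: "F \<in> two_forests n" and ab: "a < n" "b < n" "\<not> linked F a b"
  shows "insert {a, b} F \<in> spanning_trees n" "{a, b} \<notin> F" "finite F"
proof -
  from F obtain T e where T: "T \<in> spanning_trees n" and e: "e \<in> T" and F_eq: "F = T - {e}"
    by (auto simp: two_forests_def)
  obtain x y where xy: "e = {x, y}" "x \<noteq> y" "x < n" "y < n"
    using spanning_treeD(1)[OF T] e by (blast elim: complete_edgeE)
  have sides: "linked F y z \<longleftrightarrow> \<not> linked F x z" if "z < n" for z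
    using tree_edge_sides[OF T _ that, of x y] e xy F_eq by simp
  show new: "{a, b} \<notin> F" using ab(3) linked_edge[of a b F] by blast
  show fin: "finite F" using F_eq spanning_treeD(3)[OF T] by simp
  let ?T = "insert {a, b} F"
  have l: "linked ?T u v" if "linked F u v" for u v using that by (rule linked_mono) auto
  have lab: "linked ?T a b" by (intro linked_edge) auto
  have "linked ?T a z" if z: "z < n" for z
  proof (cases "linked F a z")
    case False
    have "linked F b z"
      using False ab(3) sides[OF z] sides[OF ab(1)] sides[OF ab(2)]
      by (metis linked_sym linked_trans)
    then show ?thesis using lab l by (blast intro: linked_trans)
  qed (rule l)
  then have conn: "connected_graph {..<n} ?T"
    unfolding connected_graph_iff_linked lessThan_iff Ball_def by (metis linked_sym linked_trans)
  have "card ?T = n - 1"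
    using new fin F_eq e spanning_tree_card[OF T] xy spanning_treeD(3)[OF T]
    by (metis card_Suc_Diff1 card_insert_disjoint gr_implies_not0 neq0_conv)
  moreover have "?T \<subseteq> complete_edges n"
    using F_eq spanning_treeD(1)[OF T] ab new by (auto simp: doubleton_in_complete_edges)
  ultimately show "?T \<in> spanning_trees n" using conn by (intro connected_card_imp_spanning_tree)
qed

lemma two_forestI:
  "T \<in> spanning_trees n \<Longrightarrow> e \<in> T \<Longrightarrow> T - {e} \<in> two_forests n"
  by (auto simp: two_forests_def)

definition partition_function :: "nat \<Rightarrow> (nat set \<Rightarrow> real) \<Rightarrow> real" where
  "partition_function n c = (\<Sum>T\<in>spanning_trees n. prod c T)"

definition edge_prob :: "nat \<Rightarrow> (nat set \<Rightarrow> real) \<Rightarrow> nat set \<Rightarrow> real" where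
  "edge_prob n c e = (\<Sum>T\<in>{T \<in> spanning_trees n. e \<in> T}. prod c T) / partition_function n c"

definition conductance :: "(nat set \<Rightarrow> real) \<Rightarrow> nat \<Rightarrow> nat \<Rightarrow> real" where
  "conductance c x y = (if x = y then 0 else c {x, y})"

text \<open>The potential of the unit current from \<open>u\<close> to \<open>v\<close>, as a ratio of weights of forests and trees:
  only two-component forests separating \<open>u\<close> from \<open>v\<close> count, and they count at the vertices on the
  side of \<open>u\<close>.\<close>

definition forest_potential :: "nat \<Rightarrow> (nat set \<Rightarrow> real) \<Rightarrow> nat \<Rightarrow> nat \<Rightarrow> nat \<Rightarrow> real" where
  "forest_potential n c u v z =
     (\<Sum>F\<in>two_forests n. prod c F * of_bool (linked F u z \<and> \<not> linked F u v)) /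
     partition_function n c"

text \<open>Trees through \<open>{u, v}\<close> correspond to two-component forests separating \<open>u\<close> and \<open>v\<close>, and the total
  weight of the latter is, up to normalization, the value of the potential at \<open>u\<close>.\<close>

lemma edge_prob_eq_forest_potential:
  assumes "u < n" "v < n"
  shows "edge_prob n c {u, v} =
    c {u, v} * (forest_potential n c u v u - forest_potential n c u v v)"
proof -
  have "(\<Sum>T\<in>{T \<in> spanning_trees n. {u, v} \<in> T}. prod c T) =
        (\<Sum>F\<in>{F \<in> two_forests n. \<not> linked F u v}. c {u, v} * prod c F)"
    by (rule sum.reindex_bij_witness[of _ "insert {u, v}" "\<lambda>T. T - {{u, v}}"])
      (auto simp: two_forest_join[OF _ assms] two_forestI prod.remove[of _ "{u, v}"]
        insert_absorb spanning_treeD(3) dest: tree_edge_separates)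
  also have "\<dots> = (\<Sum>F\<in>two_forests n. if \<not> linked F u v then c {u, v} * prod c F else 0)"
    by (rule sum.inter_filter[OF finite_two_forests])
  also have "\<dots> = c {u, v} * (\<Sum>F\<in>two_forests n. prod c F * of_bool (linked F u u \<and> \<not> linked F u v))"
    unfolding sum_distrib_left by (intro sum.cong) auto
  finally show ?thesis by (simp add: edge_prob_def forest_potential_def)
qed

lemma sum_two_forests_extend:
  assumes x: "x < n"
  shows "(\<Sum>F\<in>two_forests n. \<Sum>y\<in>{y. y < n \<and> \<not> linked F x y}. prod c F * c {x, y} * \<phi> F y) =
    (\<Sum>T\<in>spanning_trees n. \<Sum>y\<in>{y. {x, y} \<in> T}. prod c T * \<phi> (T - {{x, y}}) y)"
proof -
  note nb = tree_edge_vertices(3)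
  have fin: "finite {y. {x, y} \<in> T}" if "T \<in> spanning_trees n" for T
  proof (rule finite_subset)
    show "{y. {x, y} \<in> T} \<subseteq> {..<n}" using nb[OF that, of x] by blast
  qed simp
  let ?S = "SIGMA F:two_forests n. {y. y < n \<and> \<not> linked F x y}"
  let ?R = "SIGMA T:spanning_trees n. {y. {x, y} \<in> T}"
  have "(\<Sum>(F, y)\<in>?S. prod c F * c {x, y} * \<phi> F y) = (\<Sum>(T, y)\<in>?R. prod c T * \<phi> (T - {{x, y}}) y)"
  proof (rule sum.reindex_bij_witness[of _ "\<lambda>(T, y). (T - {{x, y}}, y)" "\<lambda>(F, y). (insert {x, y} F, y)"])
    fix a assume "a \<in> ?S"
    then obtain F y where a: "a = (F, y)" and F: "F \<in> two_forests n" "y < n" "\<not> linked F x y"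
      by auto
    note join = two_forest_join[OF F(1) x F(2,3)]
    show "(\<lambda>(T, y). (T - {{x, y}}, y)) ((\<lambda>(F, y). (insert {x, y} F, y)) a) = a"
      using join by (simp add: a)
    show "(\<lambda>(F, y). (insert {x, y} F, y)) a \<in> ?R"
      using join by (simp add: a)
    show "(\<lambda>(T, y). prod c T * \<phi> (T - {{x, y}}) y) ((\<lambda>(F, y). (insert {x, y} F, y)) a) =
      (\<lambda>(F, y). prod c F * c {x, y} * \<phi> F y) a"
      using join by (simp add: a mult.commute[of "c {x, y}"])
  next
    fix b assume "b \<in> ?R"
    then obtain T y where b: "b = (T, y)" and T: "T \<in> spanning_trees n" "{x, y} \<in> T" by auto
    show "(\<lambda>(F, y). (insert {x, y} F, y)) ((\<lambda>(T, y). (T - {{x, y}}, y)) b) = b"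
      using T by (simp add: b insert_absorb)
    show "(\<lambda>(T, y). (T - {{x, y}}, y)) b \<in> ?S"
      using two_forestI[OF T] nb[OF T] tree_edge_separates[OF T] by (simp add: b)
  qed
  then show ?thesis
    by (subst (1 2) sum.Sigma) (use finite_two_forests finite_spanning_trees fin in auto)
qed

text \<open>Kirchhoff's node law. In the Laplacian at \<open>x\<close> only forests separating \<open>x\<close> from a neighbour \<open>y\<close>
  survive, so that the sum becomes one over trees \<open>T\<close> and edges \<open>{x, y}\<close> of \<open>T\<close>. The contribution of
  such an edge is the indicator that \<open>v\<close> lies behind it minus the indicator that \<open>u\<close> does. As every
  vertex other than \<open>x\<close> lies behind exactly one edge at \<open>x\<close>, each tree contributes its weight times
  \<open>[v \<noteq> x] - [u \<noteq> x]\<close>.\<close>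

lemma forest_potential_laplacian:
  assumes "u < n" "v < n" "x < n" and Z: "partition_function n c \<noteq> 0"
  shows "(\<Sum>y<n. conductance c x y * (forest_potential n c u v x - forest_potential n c u v y)) =
    of_bool (x = u) - of_bool (x = v)"
proof -
  define \<phi> where "\<phi> F y = (of_bool (linked F u x \<and> \<not> linked F u v) -
    of_bool (linked F u y \<and> \<not> linked F u v) :: real)" for F y
  let ?Z = "partition_function n c"
  have "(\<Sum>y<n. conductance c x y * (forest_potential n c u v x - forest_potential n c u v y)) * ?Z
     = (\<Sum>y<n. \<Sum>F\<in>two_forests n. prod c F * conductance c x y * \<phi> F y)"
    unfolding sum_distrib_right
  proof (intro sum.cong refl)
    fix y
    let ?N = "\<lambda>z. \<Sum>F\<in>two_forests n. prod c F * of_bool (linked F u z \<and> \<not> linked F u v)"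
    have "conductance c x y * (?N x / ?Z - ?N y / ?Z) * ?Z = conductance c x y * (?N x - ?N y)"
      using Z by (simp add: diff_divide_distrib[symmetric])
    also have "?N x - ?N y = (\<Sum>F\<in>two_forests n. prod c F * \<phi> F y)"
      by (simp add: \<phi>_def sum_subtractf right_diff_distrib)
    finally show "conductance c x y * (forest_potential n c u v x - forest_potential n c u v y) * ?Z =
      (\<Sum>F\<in>two_forests n. prod c F * conductance c x y * \<phi> F y)"
      by (simp add: forest_potential_def sum_distrib_left mult_ac)
  qed
  also have "\<dots> = (\<Sum>F\<in>two_forests n. \<Sum>y<n. prod c F * conductance c x y * \<phi> F y)"
    by (rule sum.swap)
  also have "\<dots> = (\<Sum>F\<in>two_forests n. \<Sum>y\<in>{y. y < n \<and> \<not> linked F x y}. prod c F * c {x, y} * \<phi> F y)"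
  proof (rule sum.cong[OF refl], rule sum.mono_neutral_cong_right)
    fix F
    show "\<forall>y\<in>{..<n} - {y. y < n \<and> \<not> linked F x y}. prod c F * conductance c x y * \<phi> F y = 0"
    proof
      fix y assume "y \<in> {..<n} - {y. y < n \<and> \<not> linked F x y}"
      then have "linked F x y" by auto
      then have "linked F u x \<longleftrightarrow> linked F u y" by (metis linked_sym linked_trans)
      then show "prod c F * conductance c x y * \<phi> F y = 0" by (simp add: \<phi>_def)
    qed
  qed (auto simp: conductance_def)
  also have "\<dots> = (\<Sum>T\<in>spanning_trees n. \<Sum>y\<in>{y. {x, y} \<in> T}. prod c T * \<phi> (T - {{x, y}}) y)"
    by (rule sum_two_forests_extend[OF assms(3)])
  also have "\<dots> = (\<Sum>T\<in>spanning_trees n. prod c T * (of_bool (x = u) - of_bool (x = v)))"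
  proof (intro sum.cong refl)
    fix T assume T: "T \<in> spanning_trees n"
    have fin: "finite {y. {x, y} \<in> T}"
    proof (rule finite_subset)
      show "{y. {x, y} \<in> T} \<subseteq> {..<n}" using tree_edge_vertices(3)[OF T, of x] by blast
    qed simp
    have count: "(\<Sum>y\<in>{y. {x, y} \<in> T}. of_bool (linked (T - {{x, y}}) y z)) = (of_bool (z \<noteq> x) :: real)"
      if "z < n" for z
    proof (cases "z = x")
      case True
      have "\<not> linked (T - {{x, y}}) y x" if "{x, y} \<in> T" for y
        using tree_edge_separates[OF T that] linked_sym[of _ y x] by blast
      then show ?thesis using True by simp
    next
      case False
      from tree_unique_branch[OF T assms(3) that this] obtain w where
        w: "{x, w} \<in> T" "linked (T - {{x, w}}) w z"
          "\<And>y. {x, y} \<in> T \<Longrightarrow> linked (T - {{x, y}}) y z \<Longrightarrow> y = w" by metis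
      have "(\<Sum>y\<in>{y. {x, y} \<in> T}. of_bool (linked (T - {{x, y}}) y z)) =
        (\<Sum>y\<in>{y. {x, y} \<in> T}. if y = w then 1 else 0 :: real)"
      proof (intro sum.cong refl)
        fix y assume "y \<in> {y. {x, y} \<in> T}"
        then have "linked (T - {{x, y}}) y z \<longleftrightarrow> y = w" using w(2) w(3)[of y] by blast
        then show "of_bool (linked (T - {{x, y}}) y z) = (if y = w then 1 else 0 :: real)" by simp
      qed
      then show ?thesis using fin w(1) False by simp
    qed
    have "\<phi> (T - {{x, y}}) y = of_bool (linked (T - {{x, y}}) y v) - of_bool (linked (T - {{x, y}}) y u)"
      if "{x, y} \<in> T" for y
    proof -
      let ?F = "T - {{x, y}}"
      have sides: "linked ?F y u \<longleftrightarrow> \<not> linked ?F x u" "linked ?F y v \<longleftrightarrow> \<not> linked ?F x v"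
        using tree_edge_sides[OF T that] assms by auto
      have "linked ?F u x \<longleftrightarrow> linked ?F x u" "linked ?F u y \<longleftrightarrow> linked ?F y u"
        using linked_sym by metis+
      moreover have "linked ?F u v \<longleftrightarrow> (linked ?F x u \<longleftrightarrow> linked ?F x v)"
      proof
        assume "linked ?F u v"
        from linked_trans[OF _ this] linked_trans[OF _ linked_sym[OF this]]
        show "linked ?F x u \<longleftrightarrow> linked ?F x v" by blast
      next
        assume eq: "linked ?F x u \<longleftrightarrow> linked ?F x v"
        obtain w where "linked ?F w u" "linked ?F w v" using eq sides by blast
        then show "linked ?F u v" by (rule linked_trans[OF linked_sym])
      qed
      ultimately show ?thesis using sides by (simp add: \<phi>_def)
    qed
    then have "(\<Sum>y\<in>{y. {x, y} \<in> T}. prod c T * \<phi> (T - {{x, y}}) y) =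
      prod c T * ((\<Sum>y\<in>{y. {x, y} \<in> T}. of_bool (linked (T - {{x, y}}) y v)) -
        (\<Sum>y\<in>{y. {x, y} \<in> T}. of_bool (linked (T - {{x, y}}) y u)))"
      by (simp add: sum_distrib_left[symmetric] sum_subtractf[symmetric])
    then show "(\<Sum>y\<in>{y. {x, y} \<in> T}. prod c T * \<phi> (T - {{x, y}}) y) =
       prod c T * (of_bool (x = u) - of_bool (x = v))"
      unfolding count[OF assms(1)] count[OF assms(2)] by auto
  qed
  also have "\<dots> = (of_bool (x = u) - of_bool (x = v)) * ?Z"
    by (simp add: partition_function_def sum_distrib_right mult.commute)
  finally show ?thesis using Z by simp
qed

section \<open>Effective resistances in finite networks\<close>

locale network =
  fixes V :: "'a set" and k :: "'a \<Rightarrow> 'a \<Rightarrow> real"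
  assumes finite_V: "finite V"
    and sym: "k x y = k y x"
    and nonneg: "0 \<le> k x y"
begin

definition energy :: "('a \<Rightarrow> real) \<Rightarrow> real" where
  "energy g = (\<Sum>x\<in>V. \<Sum>y\<in>V. k x y * (g x - g y)\<^sup>2) / 2"

text \<open>The Laplacian of \<open>f\<close> is the divergence of a unit current from \<open>u\<close> to \<open>v\<close>; the difference
  \<open>f u - f v\<close> is then the effective resistance between \<open>u\<close> and \<open>v\<close>.\<close>

definition unit_potential :: "'a \<Rightarrow> 'a \<Rightarrow> ('a \<Rightarrow> real) \<Rightarrow> bool" where
  "unit_potential u v f \<longleftrightarrow> u \<in> V \<and> v \<in> V \<and>
     (\<forall>x\<in>V. (\<Sum>y\<in>V. k x y * (f x - f y)) = of_bool (x = u) - of_bool (x = v))"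

lemma energy_nonneg: "0 \<le> energy g"
  unfolding energy_def by (auto intro!: sum_nonneg simp: nonneg)

lemma green_identity:
  assumes "unit_potential u v f"
  shows "(\<Sum>x\<in>V. \<Sum>y\<in>V. k x y * (g x - g y) * (f x - f y)) / 2 = g u - g v"
proof -
  have uv: "u \<in> V" "v \<in> V" using assms by (auto simp: unit_potential_def)
  have "(\<Sum>x\<in>V. \<Sum>y\<in>V. k x y * g x * (f x - f y)) = (\<Sum>x\<in>V. g x * (\<Sum>y\<in>V. k x y * (f x - f y)))"
    by (simp add: sum_distrib_left mult.assoc mult.left_commute)
  also have "\<dots> = (\<Sum>x\<in>V. g x * (of_bool (x = u) - of_bool (x = v)))"
    using assms by (intro sum.cong) (auto simp: unit_potential_def)
  also have "\<dots> = (\<Sum>x\<in>V. (if x = u then g x else 0) - (if x = v then g x else 0))"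
    by (intro sum.cong) auto
  also have "\<dots> = g u - g v"
    using uv finite_V by (simp add: sum_subtractf)
  finally have 1: "(\<Sum>x\<in>V. \<Sum>y\<in>V. k x y * g x * (f x - f y)) = g u - g v" .
  have "(\<Sum>x\<in>V. \<Sum>y\<in>V. k x y * g y * (f y - f x)) = (\<Sum>y\<in>V. \<Sum>x\<in>V. k x y * g y * (f y - f x))"
    by (rule sum.swap)
  also have "\<dots> = (\<Sum>x\<in>V. \<Sum>y\<in>V. k x y * g x * (f x - f y))"
    by (simp add: sym)
  finally have 2: "(\<Sum>x\<in>V. \<Sum>y\<in>V. k x y * g y * (f y - f x)) = g u - g v" using 1 by simp
  have "(\<Sum>x\<in>V. \<Sum>y\<in>V. k x y * (g x - g y) * (f x - f y)) =
    (\<Sum>x\<in>V. \<Sum>y\<in>V. k x y * g x * (f x - f y)) + (\<Sum>x\<in>V. \<Sum>y\<in>V. k x y * g y * (f y - f x))"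
    by (simp add: sum.distrib[symmetric] algebra_simps)
  with 1 2 show ?thesis by simp
qed

lemma energy_unit_potential:
  assumes "unit_potential u v f"
  shows "energy f = f u - f v"
  using green_identity[OF assms, of f] by (simp add: energy_def power2_eq_square mult.assoc)

text \<open>The Cauchy-Schwarz inequality for the energy form, in which the unit potential represents the
  functional \<open>g \<mapsto> g u - g v\<close>. Every test function gives a lower bound on the resistance.\<close>

lemma dirichlet_principle:
  assumes "unit_potential u v f"
  shows "(g u - g v)\<^sup>2 \<le> energy g * (f u - f v)"
proof -
  define a b where "a = (\<lambda>(x, y). sqrt (k x y) * (g x - g y))"
    and "b = (\<lambda>(x, y). sqrt (k x y) * (f x - f y))"
  have "(\<Sum>i\<in>V\<times>V. a i * b i) = 2 * (g u - g v)"
  proof -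
    have "a (x, y) * b (x, y) = (sqrt (k x y))\<^sup>2 * (g x - g y) * (f x - f y)" for x y
      by (simp only: a_def b_def prod.case power2_eq_square mult_ac)
    then have "(\<Sum>i\<in>V\<times>V. a i * b i) = (\<Sum>x\<in>V. \<Sum>y\<in>V. k x y * (g x - g y) * (f x - f y))"
      unfolding sum.cartesian_product by (intro sum.cong) (auto simp: nonneg)
    then show ?thesis using green_identity[OF assms, of g] by simp
  qed
  moreover have "(\<Sum>i\<in>V\<times>V. (a i)\<^sup>2) = 2 * energy g" "(\<Sum>i\<in>V\<times>V. (b i)\<^sup>2) = 2 * energy f"
    unfolding energy_def sum.cartesian_product
    by (auto simp: a_def b_def power_mult_distrib nonneg intro!: sum.cong)
  ultimately have "(2 * (g u - g v))\<^sup>2 \<le> 2 * energy g * (2 * energy f)"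
    using Cauchy_Schwarz_ineq_sum[of a b "V \<times> V"] by simp
  then have "4 * (g u - g v)\<^sup>2 \<le> 4 * (energy g * energy f)"
    unfolding power_mult_distrib by simp
  then show ?thesis by (simp add: energy_unit_potential[OF assms])
qed

lemma edge_energy_le:
  assumes "x \<in> V" "y \<in> V"
  shows "k x y * (g x - g y)\<^sup>2 \<le> energy g"
proof (cases "x = y")
  case False
  let ?t = "\<lambda>(x, y). k x y * (g x - g y)\<^sup>2"
  have "sum ?t {(x, y), (y, x)} \<le> sum ?t (V \<times> V)"
    using assms finite_V by (intro sum_mono2) (auto simp: nonneg)
  moreover have "sum ?t {(x, y), (y, x)} = 2 * (k x y * (g x - g y)\<^sup>2)"
    using False by (simp add: sym[of y x] power2_commute[of "g y"])
  ultimately show ?thesis by (simp add: energy_def sum.cartesian_product)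
qed (simp add: energy_nonneg)

text \<open>Each edge carries at most the total energy \<open>R = f u - f v\<close>, so that the potential drops by at most
  \<open>sqrt (R / s)\<close> along it; summing over the path gives \<open>R \<le> m * sqrt (R / s)\<close>. The bound is quadratic
  in the length of the path, but this is harmless where only the exponential scale of the
  conductances matters.\<close>

lemma path_bound:
  assumes f: "unit_potential u v f" and s: "s > 0"
    and r: "(u, v) \<in> r ^^ m" "\<And>x y. (x, y) \<in> r \<Longrightarrow> x \<in> V \<and> y \<in> V \<and> k x y \<ge> s"
  shows "f u - f v \<le> (real m)\<^sup>2 / s"
proof -
  define q where "q = sqrt (energy f / s)"
  have edge: "\<bar>f x - f y\<bar> \<le> q" if "(x, y) \<in> r" for x y
  proof -
    have "s * (f x - f y)\<^sup>2 \<le> k x y * (f x - f y)\<^sup>2"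
      using r(2)[OF that] by (intro mult_right_mono) auto
    also have "\<dots> \<le> energy f" using r(2)[OF that] by (intro edge_energy_le) auto
    finally have "(f x - f y)\<^sup>2 \<le> energy f / s" using s by (simp add: field_simps)
    then show ?thesis unfolding q_def by (metis real_sqrt_abs real_sqrt_le_mono)
  qed
  have "\<bar>f u - f z\<bar> \<le> real j * q" if "(u, z) \<in> r ^^ j" for j z
    using that
  proof (induction j arbitrary: z)
    case (Suc j)
    then obtain y where "(u, y) \<in> r ^^ j" "(y, z) \<in> r" by auto
    with Suc.IH edge[of y z] show ?case by (fastforce simp: algebra_simps)
  qed simp
  from this[OF r(1)] have "(f u - f v)\<^sup>2 \<le> (real m * q)\<^sup>2"
    by (metis abs_ge_zero power2_abs power_mono)
  also have "\<dots> = (real m)\<^sup>2 * ((f u - f v) / s)"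
    using s energy_nonneg[of f]
    by (simp add: q_def power_mult_distrib energy_unit_potential[OF f])
  finally have *: "(f u - f v) * (f u - f v) \<le> ((real m)\<^sup>2 / s) * (f u - f v)"
    by (simp add: power2_eq_square)
  have "f u - f v \<ge> 0" using energy_nonneg[of f] energy_unit_potential[OF f] by simp
  then show ?thesis using * s
    by (cases "f u - f v = 0") (simp, metis mult_right_le_imp_le order_le_less)
qed

text \<open>The test function that is \<open>1\<close> at \<open>u\<close>, \<open>-1\<close> at \<open>v\<close> and \<open>0\<close> elsewhere.\<close>

lemma resistance_lower_bound:
  assumes f: "unit_potential u v f" and "u \<noteq> v"
    and pos: "0 < k u v"
  shows "4 / ((\<Sum>y\<in>V. k u y) + (\<Sum>y\<in>V. k v y) + 2 * k u v) \<le> f u - f v"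
proof -
  have uv: "u \<in> V" "v \<in> V" using f by (auto simp: unit_potential_def)
  define g where "g = (\<lambda>x. of_bool (x = u) - of_bool (x = v) :: real)"
  let ?S = "(\<Sum>y\<in>V. k u y) + (\<Sum>y\<in>V. k v y)"
  have "(\<Sum>x\<in>V. \<Sum>y\<in>V. k x y * (g x - g y)\<^sup>2) \<le>
    (\<Sum>x\<in>V. \<Sum>y\<in>V. k x y * (of_bool (x = u) + of_bool (x = v) + of_bool (y = u) + of_bool (y = v)
       + 2 * of_bool (x = u \<and> y = v) + 2 * of_bool (x = v \<and> y = u)))"
    by (intro sum_mono mult_left_mono nonneg) (auto simp: g_def \<open>u \<noteq> v\<close> power2_eq_square)
  also have "\<dots> = 2 * ?S + 4 * k u v"
  proof -
    have a: "(\<Sum>x\<in>V. \<Sum>y\<in>V. k x y * of_bool (x = w)) = (\<Sum>y\<in>V. k w y)" if "w \<in> V" for w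
    proof -
      have "(\<Sum>x\<in>V. \<Sum>y\<in>V. k x y * of_bool (x = w)) = (\<Sum>x\<in>V. if x = w then \<Sum>y\<in>V. k x y else 0)"
        by (intro sum.cong) auto
      then show ?thesis using that finite_V by simp
    qed
    have b: "(\<Sum>x\<in>V. \<Sum>y\<in>V. k x y * of_bool (y = w)) = (\<Sum>y\<in>V. k w y)" if "w \<in> V" for w
      using a[OF that] by (subst sum.swap) (simp add: sym)
    have c: "(\<Sum>x\<in>V. \<Sum>y\<in>V. k x y * of_bool (x = w \<and> y = z)) = k w z" if "w \<in> V" "z \<in> V" for w z
    proof -
      have "(\<Sum>x\<in>V. \<Sum>y\<in>V. k x y * of_bool (x = w \<and> y = z)) =
        (\<Sum>x\<in>V. if x = w then \<Sum>y\<in>V. if y = z then k x y else 0 else 0)"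
        by (intro sum.cong) (auto intro!: sum.cong)
      then show ?thesis using that finite_V by simp
    qed
    have d: "(\<Sum>x\<in>V. \<Sum>y\<in>V. k x y * (2 * of_bool (x = w \<and> y = z))) = 2 * k w z"
      if "w \<in> V" "z \<in> V" for w z
      using c[OF that] by (simp add: sum_distrib_left[symmetric] mult.left_commute[of _ 2])
    show ?thesis
      by (simp only: distrib_left sum.distrib a b d uv) (simp add: sym[of v u])
  qed
  finally have en: "energy g \<le> ?S + 2 * k u v" by (simp add: energy_def)
  have S: "0 \<le> ?S" by (intro add_nonneg_nonneg sum_nonneg nonneg)
  have "0 \<le> f u - f v" using energy_nonneg[of f] energy_unit_potential[OF f] by simp
  then have "4 \<le> (?S + 2 * k u v) * (f u - f v)"
    using dirichlet_principle[OF f, of g] mult_right_mono[OF en] \<open>u \<noteq> v\<close>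
    by (fastforce simp: g_def)
  then show ?thesis using S pos by (simp add: divide_le_eq mult.commute)
qed

text \<open>Expansion of sets extends to nonnegative functions, which are positive combinations of indicators
  of nested sets. Subtracting the smallest positive value from the support \<open>S\<close> lowers the right-hand
  side by exactly that value times the weight of the cut around \<open>S\<close>, and makes the support smaller.\<close>

lemma coarea_inequality:
  fixes H :: real
  assumes cut: "\<And>S. S \<subseteq> V \<Longrightarrow> S \<subseteq> A \<Longrightarrow> H * real (card S) \<le> (\<Sum>x\<in>S. \<Sum>y\<in>V-S. k x y)"
    and h: "\<And>x. x \<in> V \<Longrightarrow> 0 \<le> h x" "{x \<in> V. 0 < h x} \<subseteq> A"
  shows "H * (\<Sum>x\<in>V. h x) \<le> (\<Sum>x\<in>V. \<Sum>y\<in>V. k x y * max 0 (h x - h y))"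
  using h
proof (induction "card {x \<in> V. 0 < h x}" arbitrary: h rule: less_induct)
  case less
  define S where "S = {x \<in> V. 0 < h x}"
  have S: "S \<subseteq> V" "S \<subseteq> A" "finite S" using less.prems finite_V by (auto simp: S_def)
  show ?case
  proof (cases "S = {}")
    case True
    then have "h x = 0" if "x \<in> V" for x using less.prems(1)[OF that] that by (force simp: S_def)
    then show ?thesis by (auto intro!: sum_nonneg mult_nonneg_nonneg nonneg)
  next
    case False
    \<comment> \<open>lower the function by its smallest positive value on its support\<close>
    define m where "m = Min (h ` S)"
    have m_le: "m \<le> h x" if "x \<in> S" for x using that S by (simp add: m_def)
    have "m \<in> h ` S" unfolding m_def using False S by (intro Min_in) auto
    then obtain s where s: "s \<in> S" "h s = m" by blast
    have "m > 0" using s by (auto simp: S_def)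
    define h' where "h' x = (if x \<in> S then h x - m else h x)" for x
    have out: "h x = 0" if "x \<in> V - S" for x using less.prems(1)[of x] that by (force simp: S_def)
    have sub: "{x \<in> V. 0 < h' x} \<subseteq> S - {s}"
      using s by (auto simp: h'_def S_def)
    have card_less: "card {x \<in> V. 0 < h' x} < card S"
      using sub S s by (metis card_Diff1_less card_mono finite_Diff le_less_trans)
    have IH: "H * (\<Sum>x\<in>V. h' x) \<le> (\<Sum>x\<in>V. \<Sum>y\<in>V. k x y * max 0 (h' x - h' y))"
    proof (rule less.hyps)
      show "card {x \<in> V. 0 < h' x} < card {x \<in> V. 0 < h x}"
        using card_less by (simp add: S_def)
      show "0 \<le> h' x" if "x \<in> V" for x
        using m_le[of x] less.prems(1)[OF that] by (auto simp: h'_def)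
      show "{x \<in> V. 0 < h' x} \<subseteq> A" using sub S by blast
    qed
    have split: "(\<Sum>x\<in>V. g x) = (\<Sum>x\<in>S. g x) + (\<Sum>x\<in>V-S. g x)" for g :: "'a \<Rightarrow> real"
      using sum.subset_diff[OF S(1) finite_V, of g] by simp
    have "(\<Sum>x\<in>V. h x) = (\<Sum>x\<in>V. h' x) + m * card S"
      by (simp add: split h'_def sum_subtractf)
    then have "H * (\<Sum>x\<in>V. h x) = H * (\<Sum>x\<in>V. h' x) + m * (H * real (card S))"
      by (simp add: algebra_simps)
    also have "\<dots> \<le> (\<Sum>x\<in>V. \<Sum>y\<in>V. k x y * max 0 (h' x - h' y)) + m * (\<Sum>x\<in>S. \<Sum>y\<in>V-S. k x y)"
      using IH cut[OF S(1,2)] \<open>m > 0\<close> by (intro add_mono mult_left_mono) auto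
    also have "m * (\<Sum>x\<in>S. \<Sum>y\<in>V-S. k x y) = (\<Sum>x\<in>V. \<Sum>y\<in>V. k x y * (m * of_bool (x \<in> S \<and> y \<notin> S)))"
      by (simp add: split sum_distrib_left mult.commute)
    also have "(\<Sum>x\<in>V. \<Sum>y\<in>V. k x y * max 0 (h' x - h' y)) + \<dots> =
      (\<Sum>x\<in>V. \<Sum>y\<in>V. k x y * (max 0 (h' x - h' y) + m * of_bool (x \<in> S \<and> y \<notin> S)))"
      by (simp add: sum.distrib distrib_left)
    also have "\<dots> = (\<Sum>x\<in>V. \<Sum>y\<in>V. k x y * max 0 (h x - h y))"
    proof (intro sum.cong refl arg_cong2[where f = "(*)"])
      fix x y assume "x \<in> V" "y \<in> V"
      then show "max 0 (h' x - h' y) + m * of_bool (x \<in> S \<and> y \<notin> S) = max 0 (h x - h y)"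
        using out[of x] out[of y] m_le[of x] m_le[of y] \<open>m > 0\<close> by (auto simp: h'_def)
    qed
    finally show ?thesis .
  qed
qed

text \<open>Cheeger's inequality for functions supported on sets that expand: the coarea inequality is applied
  to the square of \<open>g\<close>, and the cut weight of the square is split into the energy and the degree-weighted
  norm of \<open>g\<close>.\<close>

lemma cheeger_one_sided:
  fixes H :: real
  assumes cut: "\<And>S. S \<subseteq> V \<Longrightarrow> S \<subseteq> A \<Longrightarrow> H * real (card S) \<le> (\<Sum>x\<in>S. \<Sum>y\<in>V-S. k x y)"
    and g: "\<And>x. x \<in> V \<Longrightarrow> 0 \<le> g x" "{x \<in> V. 0 < g x} \<subseteq> A"
    and deg: "\<And>x. x \<in> V \<Longrightarrow> (\<Sum>y\<in>V. k x y) \<le> D" and "0 < H" "0 < D"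
  shows "(\<Sum>x\<in>V. (g x)\<^sup>2) \<le> 2 * D / H\<^sup>2 * energy g"
proof -
  \<comment> \<open>the weight in the inequality of arithmetic and geometric means; it makes the degree term half of the left-hand side\<close>
  define \<theta> where "\<theta> = H / (2 * D)"
  have \<theta>: "\<theta> > 0" using assms by (simp add: \<theta>_def)
  let ?G = "\<Sum>x\<in>V. (g x)\<^sup>2"
  have half: "(\<Sum>x\<in>V. \<Sum>y\<in>V. k x y * max 0 ((g x)\<^sup>2 - (g y)\<^sup>2)) =
     (\<Sum>x\<in>V. \<Sum>y\<in>V. k x y * \<bar>(g x)\<^sup>2 - (g y)\<^sup>2\<bar>) / 2"
  proof -
    have "(\<Sum>x\<in>V. \<Sum>y\<in>V. k x y * max 0 ((g x)\<^sup>2 - (g y)\<^sup>2)) =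
          (\<Sum>x\<in>V. \<Sum>y\<in>V. k x y * max 0 ((g y)\<^sup>2 - (g x)\<^sup>2))"
      by (subst sum.swap) (simp add: sym)
    moreover have "(\<Sum>x\<in>V. \<Sum>y\<in>V. k x y * \<bar>(g x)\<^sup>2 - (g y)\<^sup>2\<bar>) =
      (\<Sum>x\<in>V. \<Sum>y\<in>V. k x y * max 0 ((g x)\<^sup>2 - (g y)\<^sup>2)) + (\<Sum>x\<in>V. \<Sum>y\<in>V. k x y * max 0 ((g y)\<^sup>2 - (g x)\<^sup>2))"
      by (simp only: sum.distrib[symmetric] distrib_left[symmetric])
        (intro sum.cong refl arg_cong2[where f = "(*)"], auto simp: max_def)
    ultimately show ?thesis by simp
  qed
  have amgm: "\<bar>(g x)\<^sup>2 - (g y)\<^sup>2\<bar> \<le> (g x - g y)\<^sup>2 / (2 * \<theta>) + \<theta> * ((g x)\<^sup>2 + (g y)\<^sup>2)" for x y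
  proof -
    define a b where "a = \<bar>g x - g y\<bar>" and "b = \<bar>g x + g y\<bar>"
    have "0 \<le> (a - \<theta> * b)\<^sup>2" by simp
    then have "2 * \<theta> * (a * b) \<le> a\<^sup>2 + \<theta>\<^sup>2 * b\<^sup>2" by (simp add: power2_diff power_mult_distrib algebra_simps)
    then have "a * b \<le> a\<^sup>2 / (2 * \<theta>) + \<theta> / 2 * b\<^sup>2"
      using \<theta> by (simp add: field_simps power2_eq_square)
    also have "b\<^sup>2 \<le> 2 * ((g x)\<^sup>2 + (g y)\<^sup>2)"
      using zero_le_power2[of "g x - g y"] by (simp add: b_def power2_sum power2_diff)
    then have "\<theta> / 2 * b\<^sup>2 \<le> \<theta> * ((g x)\<^sup>2 + (g y)\<^sup>2)"
      using \<theta> mult_left_mono[of "b\<^sup>2" _ "\<theta> / 2"] by fastforce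
    also have "a * b = \<bar>(g x)\<^sup>2 - (g y)\<^sup>2\<bar>"
      by (simp add: a_def b_def abs_mult[symmetric] square_diff_square_factored power2_eq_square mult.commute)
    finally show ?thesis by (simp add: a_def)
  qed
  have degsum: "(\<Sum>x\<in>V. \<Sum>y\<in>V. k x y * ((g x)\<^sup>2 + (g y)\<^sup>2)) \<le> 2 * D * ?G"
  proof -
    have 1: "(\<Sum>x\<in>V. \<Sum>y\<in>V. k x y * (g x)\<^sup>2) \<le> D * ?G"
      unfolding sum_distrib_left sum_distrib_right[symmetric]
      by (intro sum_mono mult_right_mono deg) auto
    have 2: "(\<Sum>x\<in>V. \<Sum>y\<in>V. k x y * (g y)\<^sup>2) = (\<Sum>x\<in>V. \<Sum>y\<in>V. k x y * (g x)\<^sup>2)"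
      by (subst sum.swap) (simp add: sym)
    show ?thesis using 1 2 by (simp add: distrib_left sum.distrib)
  qed
  have "H * ?G \<le> (\<Sum>x\<in>V. \<Sum>y\<in>V. k x y * max 0 ((g x)\<^sup>2 - (g y)\<^sup>2))"
  proof (rule coarea_inequality[OF cut])
    have "x \<in> A" if "x \<in> V" "g x \<noteq> 0" for x using g(1)[OF that(1)] g(2) that by force
    then show "{x \<in> V. 0 < (g x)\<^sup>2} \<subseteq> A" by auto
  qed auto
  also have "\<dots> = (\<Sum>x\<in>V. \<Sum>y\<in>V. k x y * \<bar>(g x)\<^sup>2 - (g y)\<^sup>2\<bar>) / 2" by (rule half)
  also have "\<dots> \<le> (\<Sum>x\<in>V. \<Sum>y\<in>V. k x y * ((g x - g y)\<^sup>2 / (2 * \<theta>) + \<theta> * ((g x)\<^sup>2 + (g y)\<^sup>2))) / 2"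
    by (intro divide_right_mono sum_mono mult_left_mono amgm nonneg) auto
  also have "(\<Sum>x\<in>V. \<Sum>y\<in>V. k x y * ((g x - g y)\<^sup>2 / (2 * \<theta>) + \<theta> * ((g x)\<^sup>2 + (g y)\<^sup>2))) =
      energy g / \<theta> + \<theta> * (\<Sum>x\<in>V. \<Sum>y\<in>V. k x y * ((g x)\<^sup>2 + (g y)\<^sup>2))"
    unfolding energy_def
    by (simp add: distrib_left sum.distrib sum_distrib_left sum_divide_distrib mult_ac)
  also have "(energy g / \<theta> + \<theta> * (\<Sum>x\<in>V. \<Sum>y\<in>V. k x y * ((g x)\<^sup>2 + (g y)\<^sup>2))) / 2 \<le>
     (energy g / \<theta> + \<theta> * (2 * D * ?G)) / 2"
    using degsum \<theta> by (intro divide_right_mono add_mono mult_left_mono) auto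
  also have "\<dots> = energy g * D / H + H * ?G / 2"
    using assms by (simp add: \<theta>_def field_simps)
  finally have "H * ?G / 2 \<le> energy g * D / H" by linarith
  then show ?thesis using \<open>0 < H\<close> by (simp add: field_simps power2_eq_square)
qed

lemma median_exists:
  fixes f :: "'a \<Rightarrow> real"
  assumes "V \<noteq> {}"
  obtains m where "2 * card {x \<in> V. m < f x} \<le> card V" "2 * card {x \<in> V. f x < m} \<le> card V"
proof -
  \<comment> \<open>the median is the least value of \<open>f\<close> exceeded by at most half of the vertices\<close>
  define M where "M = {t \<in> f ` V. 2 * card {x \<in> V. t < f x} \<le> card V}"
  have "f x \<le> Max (f ` V)" if "x \<in> V" for x using finite_V that by simp
  then have no_larger: "{x \<in> V. Max (f ` V) < f x} = {}" by force
  have "Max (f ` V) \<in> M"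
    unfolding M_def mem_Collect_eq no_larger using assms finite_V by simp
  moreover have "finite M" using finite_V by (simp add: M_def)
  ultimately have m: "Min M \<in> M" "\<And>t. t \<in> M \<Longrightarrow> Min M \<le> t" by (auto intro: Min_in)
  have "2 * card {x \<in> V. f x < Min M} \<le> card V"
  proof (cases "{x \<in> V. f x < Min M} = {}")
    case False
    define t where "t = Max (f ` {x \<in> V. f x < Min M})"
    have "t \<in> f ` {x \<in> V. f x < Min M}" unfolding t_def using False finite_V by (intro Max_in) auto
    then have t: "t \<in> f ` V" "t < Min M" by auto
    have le: "f x \<le> t" if "x \<in> V" "f x < Min M" for x
      unfolding t_def using that finite_V by (intro Max_ge) auto
    have "t \<notin> M" using m(2) t by force
    then have "card V < 2 * card {x \<in> V. t < f x}" using t by (simp add: M_def)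
    moreover have "card {x \<in> V. f x < Min M} + card {x \<in> V. t < f x} \<le> card V"
      using finite_V le by (subst card_Un_disjoint[symmetric]) (force intro!: card_mono)+
    ultimately show ?thesis by linarith
  next
    case True
    show ?thesis unfolding True by simp
  qed
  with m that show ?thesis by (auto simp: M_def)
qed

text \<open>Centering the potential at a median makes its positive and its negative part supported on at most
  half of the vertices, where Cheeger's inequality applies. So the squared distances from the median
  at \<open>u\<close> and \<open>v\<close> are at most a constant times the energy, which is the resistance itself.\<close>

lemma resistance_upper_bound:
  fixes H :: real
  assumes f: "unit_potential u v f" and uv: "u \<noteq> v"
    and cut: "\<And>S. S \<subseteq> V \<Longrightarrow> 2 * card S \<le> card V \<Longrightarrow> H * real (card S) \<le> (\<Sum>x\<in>S. \<Sum>y\<in>V-S. k x y)"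
    and deg: "\<And>x. x \<in> V \<Longrightarrow> (\<Sum>y\<in>V. k x y) \<le> D" and "0 < H" "0 < D"
  shows "f u - f v \<le> 4 * D / H\<^sup>2"
proof -
  have V: "u \<in> V" "v \<in> V" using f by (auto simp: unit_potential_def)
  from median_exists[of f] V obtain m where
    m: "2 * card {x \<in> V. m < f x} \<le> card V" "2 * card {x \<in> V. f x < m} \<le> card V" by blast
  define p q where "p x = max 0 (f x - m)" and "q x = max 0 (m - f x)" for x
  have small: "2 * card S \<le> card V" if "S \<subseteq> A" "A \<subseteq> V" "2 * card A \<le> card V" for S A
    using that finite_V by (meson card_mono finite_subset le_trans mult_le_mono2)
  have P: "(\<Sum>x\<in>V. (p x)\<^sup>2) \<le> 2 * D / H\<^sup>2 * energy p"
    by (rule cheeger_one_sided[where A = "{x \<in> V. m < f x}"])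
      (use assms m small in \<open>auto simp: p_def\<close>)
  have Q: "(\<Sum>x\<in>V. (q x)\<^sup>2) \<le> 2 * D / H\<^sup>2 * energy q"
    by (rule cheeger_one_sided[where A = "{x \<in> V. f x < m}"])
      (use assms m small in \<open>auto simp: q_def\<close>)
  have "energy p + energy q = (\<Sum>x\<in>V. \<Sum>y\<in>V. k x y * ((p x - p y)\<^sup>2 + (q x - q y)\<^sup>2)) / 2"
    by (simp add: energy_def distrib_left sum.distrib add_divide_distrib)
  also have "\<dots> \<le> energy f"
    unfolding energy_def
  proof (intro divide_right_mono sum_mono mult_left_mono nonneg)
    fix x y
    have "0 \<le> (p x * q y + p y * q x)" by (simp add: p_def q_def)
    moreover have "p x * q x = 0" "p y * q y = 0" by (simp_all add: p_def q_def max_def)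
    moreover have "(p x - p y) * (q x - q y) = p x * q x + p y * q y - (p x * q y + p y * q x)"
      by (simp add: algebra_simps)
    ultimately have neg: "(p x - p y) * (q x - q y) \<le> 0" by linarith
    have eq: "f x - f y = (p x - p y) - (q x - q y)" by (simp add: p_def q_def max_def)
    show "(p x - p y)\<^sup>2 + (q x - q y)\<^sup>2 \<le> (f x - f y)\<^sup>2"
      unfolding eq power2_diff[of "p x - p y" "q x - q y"] using neg by linarith
  qed auto
  also have "\<dots> = f u - f v" by (rule energy_unit_potential[OF f])
  finally have en: "energy p + energy q \<le> f u - f v" .
  have pq: "(f x - m)\<^sup>2 = (p x)\<^sup>2 + (q x)\<^sup>2" for x by (simp add: p_def q_def max_def power2_commute)
  have "(f u - m)\<^sup>2 + (f v - m)\<^sup>2 = (\<Sum>x\<in>{u, v}. (f x - m)\<^sup>2)" using uv by simp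
  also have "\<dots> \<le> (\<Sum>x\<in>V. (f x - m)\<^sup>2)"
    using V finite_V by (intro sum_mono2) auto
  also have "\<dots> \<le> 2 * D / H\<^sup>2 * (energy p + energy q)"
    using P Q by (simp add: pq sum.distrib distrib_left)
  also have "\<dots> \<le> 2 * D / H\<^sup>2 * (f u - f v)"
    using en assms by (intro mult_left_mono) auto
  finally have 1: "(f u - m)\<^sup>2 + (f v - m)\<^sup>2 \<le> 2 * D / H\<^sup>2 * (f u - f v)" .
  have "0 \<le> ((f u - m) + (f v - m))\<^sup>2" by simp
  then have "(f u - f v)\<^sup>2 \<le> 2 * ((f u - m)\<^sup>2 + (f v - m)\<^sup>2)"
    by (simp add: power2_eq_square algebra_simps)
  with 1 have 2: "(f u - f v) * (f u - f v) \<le> (4 * D / H\<^sup>2) * (f u - f v)"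
    by (simp add: power2_eq_square)
  have "f u - f v \<ge> 0" using energy_nonneg[of f] energy_unit_potential[OF f] by simp
  then show ?thesis using 2 assms(5,6)
    by (cases "f u - f v = 0") (simp, metis mult_right_le_imp_le order_le_less)
qed

end

section \<open>Edge probabilities and the expected overlap\<close>

lemma network_conductance:
  assumes "\<And>e. 0 < c e"
  shows "network {..<n} (conductance c)"
  by unfold_locales (auto simp: conductance_def insert_commute less_imp_le[OF assms])

lemma partition_function_pos:
  assumes "\<And>e. 0 < c e" "n > 0"
  shows "0 < partition_function n c"
  unfolding partition_function_def
  using ex_spanning_tree[OF assms(2)] finite_spanning_trees assms(1)
  by (intro sum_pos prod_pos) auto

text \<open>Kirchhoff's formula: the probability that an edge belongs to the tree is its conductance times the
  effective resistance between its ends.\<close>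

lemma kirchhoff:
  assumes "\<And>e. 0 < c e" "u < n" "v < n"
  obtains f where "network.unit_potential {..<n} (conductance c) u v f"
    "edge_prob n c {u, v} = c {u, v} * (f u - f v)"
proof
  have Z: "partition_function n c \<noteq> 0"
    using partition_function_pos[of c n] assms(1,2) by simp
  show "network.unit_potential {..<n} (conductance c) u v (forest_potential n c u v)"
    unfolding network.unit_potential_def[of "{..<n}" "conductance c", OF network_conductance[of c, OF assms(1)]]
    using forest_potential_laplacian[OF assms(2,3) _ Z] assms by simp
  show "edge_prob n c {u, v} =
      c {u, v} * (forest_potential n c u v u - forest_potential n c u v v)"
    by (rule edge_prob_eq_forest_potential[OF assms(2,3)])
qed

lemma edge_prob_nonneg:
  assumes "\<And>e. 0 < c e"
  shows "0 \<le> edge_prob n c e"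
  unfolding edge_prob_def partition_function_def
  by (intro divide_nonneg_nonneg sum_nonneg prod_nonneg) (auto simp: less_imp_le[OF assms])

lemma edge_prob_le_1:
  assumes "\<And>e. 0 < c e" "n > 0"
  shows "edge_prob n c e \<le> 1"
proof -
  have "(\<Sum>T\<in>{T \<in> spanning_trees n. e \<in> T}. prod c T) \<le> partition_function n c"
    unfolding partition_function_def
    by (intro sum_mono2 finite_spanning_trees prod_nonneg) (auto simp: less_imp_le[OF assms(1)])
  then show ?thesis using partition_function_pos[OF assms] by (simp add: edge_prob_def)
qed

lemma edge_prob_altdef:
  "edge_prob n c e = (\<Sum>T\<in>spanning_trees n. of_bool (e \<in> T) * (prod c T / partition_function n c))"
proof -
  have "(\<Sum>T\<in>{T \<in> spanning_trees n. e \<in> T}. prod c T) =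
    (\<Sum>T\<in>spanning_trees n. if e \<in> T then prod c T else 0)"
    by (rule sum.inter_filter[OF finite_spanning_trees])
  also have "\<dots> = (\<Sum>T\<in>spanning_trees n. of_bool (e \<in> T) * prod c T)"
    by (intro sum.cong) auto
  finally show ?thesis by (simp add: edge_prob_def sum_divide_distrib)
qed

text \<open>Every spanning tree has \<open>n - 1\<close> edges. In terms of resistances this is Foster's theorem.\<close>

lemma sum_edge_prob:
  assumes "\<And>e. 0 < c e" "n > 0"
  shows "(\<Sum>e\<in>complete_edges n. edge_prob n c e) = real n - 1"
proof -
  let ?Z = "partition_function n c"
  have "(\<Sum>e\<in>complete_edges n. edge_prob n c e) =
    (\<Sum>T\<in>spanning_trees n. \<Sum>e\<in>complete_edges n. of_bool (e \<in> T) * (prod c T / ?Z))"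
    unfolding edge_prob_altdef by (rule sum.swap)
  also have "\<dots> = (\<Sum>T\<in>spanning_trees n. (real n - 1) * (prod c T / ?Z))"
  proof (intro sum.cong refl)
    fix T assume T: "T \<in> spanning_trees n"
    have "(\<Sum>e\<in>complete_edges n. of_bool (e \<in> T)) = real (card (complete_edges n \<inter> T))"
      by (simp add: finite_complete_edges Int_def)
    also have "complete_edges n \<inter> T = T" using spanning_treeD(1)[OF T] by blast
    also have "real (card T) = real n - 1" using spanning_tree_card[OF T] assms(2) by simp
    finally show "(\<Sum>e\<in>complete_edges n. of_bool (e \<in> T) * (prod c T / ?Z)) =
      (real n - 1) * (prod c T / ?Z)"
      by (simp only: sum_distrib_right[symmetric])
  qed
  also have "\<dots> = (real n - 1) * (?Z / ?Z)"
    unfolding partition_function_def sum_distrib_left[symmetric] sum_divide_distrib[symmetric] ..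
  finally show ?thesis using partition_function_pos[of c n] assms by simp
qed

text \<open>Two independent trees share the edge \<open>e\<close> with the square of the probability that one of them
  contains it.\<close>

lemma expected_overlap_eq_sum_squares:
  "expected_overlap n b \<omega> = (\<Sum>e\<in>complete_edges n. (edge_prob n (\<lambda>e. exp (- b * \<omega> e)) e)\<^sup>2)"
proof -
  let ?c = "\<lambda>e. exp (- b * \<omega> e)"
  let ?p = "\<lambda>T. prod ?c T / partition_function n ?c"
  have p: "rstre_prob n b \<omega> T = ?p T" if "T \<in> spanning_trees n" for T
    using that by (simp add: rstre_prob_def tree_weight_def partition_function_def)
  have card: "real (card (T \<inter> T')) = (\<Sum>e\<in>complete_edges n. of_bool (e \<in> T) * of_bool (e \<in> T'))"
    if "T \<in> spanning_trees n" for T T'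
  proof -
    have "(\<Sum>e\<in>complete_edges n. of_bool (e \<in> T) * of_bool (e \<in> T')) =
       (\<Sum>e\<in>complete_edges n. of_bool (e \<in> T \<inter> T') :: real)" by (intro sum.cong) auto
    also have "\<dots> = real (card (complete_edges n \<inter> (T \<inter> T')))"
      by (simp add: finite_complete_edges Int_def)
    also have "complete_edges n \<inter> (T \<inter> T') = T \<inter> T'" using spanning_treeD(1)[OF that] by blast
    finally show ?thesis by simp
  qed
  have "expected_overlap n b \<omega> = (\<Sum>T\<in>spanning_trees n. \<Sum>T'\<in>spanning_trees n.
      \<Sum>e\<in>complete_edges n. (of_bool (e \<in> T) * ?p T) * (of_bool (e \<in> T') * ?p T'))"
    unfolding expected_overlap_def
  proof (intro sum.cong refl)
    fix T T' assume T: "T \<in> spanning_trees n" "T' \<in> spanning_trees n"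
    show "real (card (T \<inter> T')) * rstre_prob n b \<omega> T * rstre_prob n b \<omega> T' =
      (\<Sum>e\<in>complete_edges n. (of_bool (e \<in> T) * ?p T) * (of_bool (e \<in> T') * ?p T'))"
      unfolding card[OF T(1)] p[OF T(1)] p[OF T(2)] sum_distrib_right
      by (intro sum.cong refl) (simp only: mult_ac)
  qed
  also have "\<dots> = (\<Sum>T\<in>spanning_trees n. \<Sum>e\<in>complete_edges n. \<Sum>T'\<in>spanning_trees n.
      (of_bool (e \<in> T) * ?p T) * (of_bool (e \<in> T') * ?p T'))"
    by (intro sum.cong refl sum.swap)
  also have "\<dots> = (\<Sum>e\<in>complete_edges n. \<Sum>T\<in>spanning_trees n. \<Sum>T'\<in>spanning_trees n.
      (of_bool (e \<in> T) * ?p T) * (of_bool (e \<in> T') * ?p T'))"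
    by (rule sum.swap)
  also have "\<dots> = (\<Sum>e\<in>complete_edges n. (edge_prob n ?c e)\<^sup>2)"
    unfolding edge_prob_altdef power2_eq_square sum_product ..
  finally show ?thesis .
qed

lemma edge_prob_ge_degrees:
  assumes "\<And>e. 0 < c e" "u < n" "v < n" "u \<noteq> v"
  shows "c {u, v} * (4 / ((\<Sum>y<n. conductance c u y) + (\<Sum>y<n. conductance c v y) + 2 * c {u, v}))
    \<le> edge_prob n c {u, v}"
proof -
  interpret network "{..<n}" "conductance c" by (rule network_conductance[of c, OF assms(1)])
  obtain f where f: "unit_potential u v f" "edge_prob n c {u, v} = c {u, v} * (f u - f v)"
    by (rule kirchhoff[of c u n v, OF assms(1-3)])
  have "conductance c u v = c {u, v}" using assms(4) by (simp add: conductance_def)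
  with resistance_lower_bound[OF f(1) assms(4)] assms(1)
  show ?thesis unfolding f(2) by (intro mult_left_mono) (auto simp: less_imp_le)
qed

lemma edge_prob_le_expansion:
  fixes D H :: real
  assumes "\<And>e. 0 < c e" "u < n" "v < n" "u \<noteq> v"
    and "\<And>S. S \<subseteq> {..<n} \<Longrightarrow> 2 * card S \<le> n \<Longrightarrow>
      H * real (card S) \<le> (\<Sum>x\<in>S. \<Sum>y\<in>{..<n} - S. conductance c x y)"
    and "\<And>x. x < n \<Longrightarrow> (\<Sum>y<n. conductance c x y) \<le> D" "0 < H" "0 < D"
  shows "edge_prob n c {u, v} \<le> c {u, v} * (4 * D / H\<^sup>2)"
proof -
  interpret network "{..<n}" "conductance c" by (rule network_conductance[of c, OF assms(1)])
  obtain f where f: "unit_potential u v f" "edge_prob n c {u, v} = c {u, v} * (f u - f v)"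
    by (rule kirchhoff[of c u n v, OF assms(1-3)])
  have "f u - f v \<le> 4 * D / H\<^sup>2"
    by (rule resistance_upper_bound[OF f(1) assms(4)]) (use assms in auto)
  then show ?thesis unfolding f(2) using assms(1) by (intro mult_left_mono) (auto simp: less_imp_le)
qed

text \<open>The number of steps needed to join \<open>u\<close> and \<open>v\<close> is bounded crudely by \<open>n\<^sup>2\<close>, the number of ordered
  pairs of vertices.\<close>

lemma edge_prob_le_path:
  fixes s :: real
  assumes "\<And>e. 0 < c e" "u < n" "v < n" "0 < s"
    and F: "F \<subseteq> complete_edges n" "\<And>e. e \<in> F \<Longrightarrow> s \<le> c e" "linked F u v"
  shows "edge_prob n c {u, v} \<le> c {u, v} * (real n ^ 4 / s)"
proof -
  interpret network "{..<n}" "conductance c" by (rule network_conductance[of c, OF assms(1)])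
  obtain f where f: "unit_potential u v f" "edge_prob n c {u, v} = c {u, v} * (f u - f v)"
    by (rule kirchhoff[of c u n v, OF assms(1-3)])
  define r where "r = {(x, y). {x, y} \<in> F}"
  have r: "x \<noteq> y \<and> x < n \<and> y < n \<and> s \<le> c {x, y}" if "(x, y) \<in> r" for x y
    using that F(1,2) doubleton_in_complete_edges[of x y n] by (auto simp: r_def)
  then have r_sub: "r \<subseteq> {..<n} \<times> {..<n}" by auto
  then have "finite r" by (rule finite_subset) simp
  have "(u, v) \<in> r\<^sup>*" using F(3) by (simp add: linked_def r_def)
  then obtain m where m: "(u, v) \<in> r ^^ m" "m \<le> card r"
    unfolding rtrancl_finite_eq_relpow[OF \<open>finite r\<close>] by auto
  have "card r \<le> card ({..<n} \<times> {..<n})" using r_sub by (intro card_mono) auto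
  then have "real m \<le> real (n * n)"
    using m(2) by (intro of_nat_mono) (simp add: card_cartesian_product)
  then have "(real m)\<^sup>2 \<le> real n ^ 4"
    using power_mono[of "real m" "real (n * n)" 2] by (simp add: power4_eq_xxxx power2_eq_square mult_ac)
  have "f u - f v \<le> (real m)\<^sup>2 / s"
    using r by (intro path_bound[OF f(1) assms(4) m(1)]) (auto simp: conductance_def)
  also have "\<dots> \<le> real n ^ 4 / s"
    using \<open>(real m)\<^sup>2 \<le> real n ^ 4\<close> assms(4) by (intro divide_right_mono) auto
  finally show ?thesis unfolding f(2) using assms(1)
    by (intro mult_left_mono) (auto simp: less_imp_le)
qed

text \<open>If degrees are close to \<open>n * \<mu>\<close> from above, then \<open>edge_prob n c e\<close> is at least \<open>a * c e\<close> with \<open>a\<close>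
  close to \<open>2 / (n * \<mu>)\<close>. No matching pointwise upper bound is at hand, as expansion of sets controls
  resistances only up to a constant factor. But the excess over \<open>a * c e\<close> is nonnegative and its sum
  over all edges is \<open>O(\<epsilon> * n)\<close>, because the probabilities add up to \<open>n - 1\<close>. Together with the crude
  bound \<open>128 / (n * \<mu>)\<close> on every probability, the excess changes the sum of squares by only
  \<open>O(\<epsilon> / \<mu>)\<close>, which is small compared with the main term \<open>2 * \<mu>2 / \<mu>\<^sup>2\<close>.\<close>

lemma sum_squares_edge_prob_near_uniform:
  fixes \<mu> \<mu>2 \<epsilon> :: real
  assumes c: "\<And>e. 0 < c e" "\<And>e. e \<in> complete_edges n \<Longrightarrow> c e \<le> 1" and n: "n > 0"
    and \<mu>: "0 < \<mu>" "0 < \<mu>2" "\<mu> \<le> 2 * \<mu>2" and \<epsilon>: "0 < \<epsilon>" "\<epsilon> \<le> 1 / 4"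
    and deg: "\<And>x. x < n \<Longrightarrow> (\<Sum>y<n. conductance c x y) \<le> (1 + \<epsilon>) * (n * \<mu>)"
    and cut: "\<And>S. S \<subseteq> {..<n} \<Longrightarrow> 2 * card S \<le> n \<Longrightarrow>
      n * \<mu> / 4 * real (card S) \<le> (\<Sum>x\<in>S. \<Sum>y\<in>{..<n} - S. conductance c x y)"
    and total: "(1 - \<epsilon>) * (n * (real n - 1) / 2 * \<mu>) \<le> (\<Sum>e\<in>complete_edges n. c e)"
    and squares: "(1 - \<epsilon>) * (n * (real n - 1) / 2 * \<mu>2) \<le> (\<Sum>e\<in>complete_edges n. (c e)\<^sup>2)"
      "(\<Sum>e\<in>complete_edges n. (c e)\<^sup>2) \<le> (1 + \<epsilon>) * (n * (real n - 1) / 2 * \<mu>2)"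
    and large: "1 \<le> \<epsilon> * (n * \<mu>)" "1 \<le> \<epsilon> * n"
  shows "\<bar>(\<Sum>e\<in>complete_edges n. (edge_prob n c e)\<^sup>2) / (2 * \<mu>2 / \<mu>\<^sup>2) - 1\<bar> \<le> 400 * \<epsilon>"
proof -
  define M where "M = n * \<mu>"
  \<comment> \<open>four over the sum of the degree bounds \<open>2 * (1 + \<epsilon>) * M\<close> and of \<open>2 * \<epsilon> * M\<close>, which bounds the term for the edge itself\<close>
  define a where "a = 2 / (M * (1 + 2 * \<epsilon>))"
  let ?E = "complete_edges n" and ?p = "edge_prob n c"
  let ?C2 = "\<Sum>e\<in>?E. (c e)\<^sup>2"
  have M: "0 < M" using n \<mu> by (simp add: M_def)
  have M': "0 < M * (1 + 2 * \<epsilon>)" "M * 1 \<le> M * (1 + 2 * \<epsilon>)"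
    using M \<epsilon> by (intro mult_pos_pos mult_left_mono; simp)+
  have a: "0 < a" "a \<le> 2 / M" using M M' unfolding a_def by (auto intro!: divide_left_mono)
  have lower: "a * c e \<le> ?p e" if e: "e \<in> ?E" for e
  proof -
    obtain u v where uv: "e = {u, v}" "u \<noteq> v" "u < n" "v < n" using e by (rule complete_edgeE)
    let ?S = "(\<Sum>y<n. conductance c u y) + (\<Sum>y<n. conductance c v y) + 2 * c {u, v}"
    have "0 \<le> (\<Sum>y<n. conductance c x y)" for x
      by (intro sum_nonneg) (simp add: conductance_def less_imp_le[OF c(1)])
    then have S: "0 < ?S" using c(1)[of "{u, v}"] by (intro add_nonneg_pos add_nonneg_nonneg) auto
    have "?S \<le> (1 + \<epsilon>) * M + (1 + \<epsilon>) * M + 2 * (\<epsilon> * M)"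
      using deg[OF uv(3)] deg[OF uv(4)] c(2)[OF e] large(1) unfolding uv(1) M_def by linarith
    also have "\<dots> = 2 * (M * (1 + 2 * \<epsilon>))" by (simp add: algebra_simps)
    finally have "4 / (2 * (M * (1 + 2 * \<epsilon>))) \<le> 4 / ?S"
      using S M \<epsilon> by (intro divide_left_mono mult_pos_pos) auto
    then have "a \<le> 4 / ?S" by (simp add: a_def)
    then have "c e * a \<le> c e * (4 / ?S)" using c(1)[of e] by (intro mult_left_mono) auto
    then have "a * c e \<le> c e * (4 / ?S)" by (simp only: mult.commute[of a])
    also have "\<dots> \<le> ?p e" unfolding uv(1) by (rule edge_prob_ge_degrees[of c u n v, OF c(1) uv(3,4,2)])
    finally show ?thesis .
  qed
  have upper: "?p e \<le> 128 / M" if e: "e \<in> ?E" for e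
  proof -
    obtain u v where uv: "e = {u, v}" "u \<noteq> v" "u < n" "v < n" using e by (rule complete_edgeE)
    have D: "(\<Sum>y<n. conductance c x y) \<le> 2 * M" if "x < n" for x
    proof -
      have "(1 + \<epsilon>) * M \<le> 2 * M" using \<epsilon> M by (intro mult_right_mono) auto
      with deg[OF that] show ?thesis by (simp add: M_def)
    qed
    have "?p e \<le> c e * (4 * (2 * M) / (M / 4)\<^sup>2)"
      unfolding uv(1) by (rule edge_prob_le_expansion[of c u n v, OF c(1) uv(3,4,2) _ D])
        (use cut M in \<open>auto simp: M_def\<close>)
    also have "4 * (2 * M) / (M / 4)\<^sup>2 = 128 / M" using M by (simp add: power2_eq_square)
    also have "c e * (128 / M) \<le> 1 * (128 / M)"
      using c(2)[OF e] M by (intro mult_right_mono) auto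
    finally show ?thesis by simp
  qed
  define N where "N = n * (real n - 1) / 2"
  have ratio: "1 - 3 * \<epsilon> \<le> (1 - \<epsilon>) / (1 + 2 * \<epsilon>)"
    using \<epsilon> zero_le_square[of \<epsilon>] by (subst pos_le_divide_eq) (auto simp: algebra_simps)
  have n1: "real n \<ge> 1" using n by simp
  have aN: "a * (N * \<mu>) = (real n - 1) / (1 + 2 * \<epsilon>)"
  proof -
    have "2 / (n * \<mu> * q) * (n * (real n - 1) / 2 * \<mu>) = (real n - 1) / q" for q :: real
      using n \<mu> by (cases "q = 0") (auto simp: field_simps)
    from this[of "1 + 2 * \<epsilon>"] show ?thesis by (simp only: a_def N_def M_def)
  qed
  have excess: "(\<Sum>e\<in>?E. ?p e - a * c e) \<le> 3 * \<epsilon> * n"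
  proof -
    have "a * ((1 - \<epsilon>) * (N * \<mu>)) \<le> a * (\<Sum>e\<in>?E. c e)"
      using total a by (intro mult_left_mono) (auto simp: N_def)
    moreover have "a * ((1 - \<epsilon>) * (N * \<mu>)) = (1 - \<epsilon>) * (a * (N * \<mu>))" by (simp only: mult_ac)
    ultimately have "(real n - 1) * ((1 - \<epsilon>) / (1 + 2 * \<epsilon>)) \<le> a * (\<Sum>e\<in>?E. c e)"
      unfolding aN by (simp add: mult.commute)
    moreover have "(real n - 1) * (1 - 3 * \<epsilon>) \<le> (real n - 1) * ((1 - \<epsilon>) / (1 + 2 * \<epsilon>))"
      using ratio n1 by (intro mult_left_mono) auto
    ultimately have "(real n - 1) - a * (\<Sum>e\<in>?E. c e) \<le> (real n - 1) * (3 * \<epsilon>)"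
      by (simp add: algebra_simps)
    also have "\<dots> \<le> 3 * \<epsilon> * n" using \<epsilon> by (simp add: algebra_simps)
    finally show ?thesis
      using sum_edge_prob[of c n, OF c(1) n] by (simp add: sum_subtractf sum_distrib_left)
  qed
  define t where "t = 2 * \<mu>2 / \<mu>\<^sup>2"
  have t: "0 < t" using \<mu> by (simp add: t_def)
  have "1 / \<mu> \<le> t" using \<mu> by (simp add: t_def field_simps power2_eq_square)
  \<comment> \<open>the main term and the contribution of the excess\<close>
  have sq: "(?p e)\<^sup>2 = a\<^sup>2 * (c e)\<^sup>2 + (?p e - a * c e) * (?p e + a * c e)" for e
    by (simp add: power2_eq_square algebra_simps)
  have "(\<Sum>e\<in>?E. (?p e)\<^sup>2) = a\<^sup>2 * ?C2 + (\<Sum>e\<in>?E. (?p e - a * c e) * (?p e + a * c e))"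
    unfolding sq sum.distrib sum_distrib_left ..
  moreover have "(\<Sum>e\<in>?E. (?p e - a * c e) * (?p e + a * c e)) \<le> 390 * \<epsilon> * t"
  proof -
    have "(\<Sum>e\<in>?E. (?p e - a * c e) * (?p e + a * c e)) \<le> (\<Sum>e\<in>?E. (?p e - a * c e) * (130 / M))"
    proof (intro sum_mono mult_left_mono)
      fix e assume e: "e \<in> ?E"
      have "a * c e \<le> 2 / M * 1" using a c(1)[of e] c(2)[OF e] M by (intro mult_mono) auto
      then show "?p e + a * c e \<le> 130 / M"
        using upper[OF e] by (simp add: add_divide_distrib[symmetric, of 128 M 2, simplified])
      show "0 \<le> ?p e - a * c e" using lower[OF e] by simp
    qed
    also have "\<dots> = (\<Sum>e\<in>?E. ?p e - a * c e) * (130 / M)" by (simp only: sum_distrib_right)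
    also have "\<dots> \<le> 3 * \<epsilon> * n * (130 / M)" using excess M by (intro mult_right_mono) auto
    also have "\<dots> = 390 * \<epsilon> * (1 / \<mu>)" using n \<mu> by (simp add: M_def)
    also have "\<dots> \<le> 390 * \<epsilon> * t" using \<open>1 / \<mu> \<le> t\<close> \<epsilon> by (intro mult_left_mono) auto
    finally show ?thesis .
  qed
  moreover have "0 \<le> (\<Sum>e\<in>?E. (?p e - a * c e) * (?p e + a * c e))"
  proof (intro sum_nonneg mult_nonneg_nonneg)
    fix e assume e: "e \<in> ?E"
    show "0 \<le> ?p e - a * c e" using lower[OF e] by simp
    show "0 \<le> ?p e + a * c e" using a c(1)[of e] edge_prob_nonneg[of c n e, OF c(1)] by simp
  qed
  moreover have "a\<^sup>2 * ?C2 \<le> (1 + \<epsilon>) * t"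
  proof -
    have "a\<^sup>2 * ?C2 \<le> (2 / M)\<^sup>2 * ((1 + \<epsilon>) * (real n * n / 2 * \<mu>2))"
    proof (intro mult_mono power_mono)
      have "(1 + \<epsilon>) * (n * (real n - 1) / 2 * \<mu>2) \<le> (1 + \<epsilon>) * (real n * n / 2 * \<mu>2)"
        using \<epsilon> \<mu> by (intro mult_left_mono mult_right_mono divide_right_mono) auto
      then show "?C2 \<le> (1 + \<epsilon>) * (real n * n / 2 * \<mu>2)" using squares(2) by linarith
    qed (use a in \<open>auto intro: sum_nonneg\<close>)
    also have "\<dots> = (1 + \<epsilon>) * t"
      using n \<mu> by (simp add: t_def M_def power2_eq_square field_simps)
    finally show ?thesis .
  qed
  moreover have "(1 - 6 * \<epsilon>) * t \<le> a\<^sup>2 * ?C2"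
  proof -
    have n1': "(1 - \<epsilon>) * n \<le> real n - 1" using large(2) by (simp add: algebra_simps)
    have "1 - 6 * \<epsilon> \<le> (1 - 3 * \<epsilon>)\<^sup>2" by (simp add: power2_diff)
    also have "\<dots> \<le> ((1 - \<epsilon>) / (1 + 2 * \<epsilon>))\<^sup>2" using ratio \<epsilon> by (intro power_mono) auto
    finally have "(1 - 6 * \<epsilon>) * t \<le> ((1 - \<epsilon>) / (1 + 2 * \<epsilon>))\<^sup>2 * t"
      using t by (intro mult_right_mono) auto
    also have "\<dots> = a\<^sup>2 * ((1 - \<epsilon>) * (n * ((1 - \<epsilon>) * n) / 2 * \<mu>2))"
    proof -
      have "(r / q)\<^sup>2 * (2 * \<mu>2 / \<mu>\<^sup>2) = (2 / (n * \<mu> * q))\<^sup>2 * (r * (n * (r * n) / 2 * \<mu>2))" for q r :: real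
        using n \<mu> by (cases "q = 0") (auto simp: field_simps power2_eq_square)
      from this[of "1 - \<epsilon>" "1 + 2 * \<epsilon>"] show ?thesis by (simp only: a_def t_def M_def)
    qed
    also have "\<dots> \<le> a\<^sup>2 * ((1 - \<epsilon>) * (n * (real n - 1) / 2 * \<mu>2))"
      using \<epsilon> \<mu> n1' by (intro mult_left_mono mult_right_mono divide_right_mono) auto
    also have "\<dots> \<le> a\<^sup>2 * ?C2" using squares(1) by (intro mult_left_mono) auto
    finally show ?thesis .
  qed
  ultimately have "(1 - 6 * \<epsilon>) * t \<le> (\<Sum>e\<in>?E. (?p e)\<^sup>2)" "(\<Sum>e\<in>?E. (?p e)\<^sup>2) \<le> (1 + \<epsilon>) * t + 390 * \<epsilon> * t"
    by linarith+
  then have "1 - 6 * \<epsilon> \<le> (\<Sum>e\<in>?E. (?p e)\<^sup>2) / t" "(\<Sum>e\<in>?E. (?p e)\<^sup>2) / t \<le> 1 + 391 * \<epsilon>"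
    using t by (auto simp: field_simps)
  then show ?thesis using \<epsilon> unfolding t_def by (simp add: abs_le_iff)
qed

section \<open>Concentration of sums of edge weights\<close>

definition cut_edges :: "nat \<Rightarrow> nat set \<Rightarrow> nat set set" where
  "cut_edges n S = (\<lambda>(x, y). {x, y}) ` (S \<times> ({..<n} - S))"

lemma cut_edges_inj: "inj_on (\<lambda>(x, y). {x, y}) (S \<times> (W - S))"
  by (auto simp: inj_on_def doubleton_eq_iff)

lemma cut_edges_subset: "S \<subseteq> {..<n} \<Longrightarrow> cut_edges n S \<subseteq> complete_edges n"
  by (auto simp: cut_edges_def doubleton_in_complete_edges)

lemma card_cut_edges:
  assumes "S \<subseteq> {..<n}"
  shows "card (cut_edges n S) = card S * (n - card S)"
proof -
  have "finite S" using assms finite_subset by blast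
  then show ?thesis
    unfolding cut_edges_def card_image[OF cut_edges_inj] card_cartesian_product
    by (simp add: card_Diff_subset assms)
qed

lemma sum_cut_edges:
  assumes "S \<subseteq> {..<n}"
  shows "(\<Sum>e\<in>cut_edges n S. c e) = (\<Sum>x\<in>S. \<Sum>y\<in>{..<n} - S. conductance c x y)"
proof -
  have "(\<Sum>e\<in>cut_edges n S. c e) = (\<Sum>(x, y)\<in>S \<times> ({..<n} - S). c {x, y})"
    unfolding cut_edges_def by (subst sum.reindex[OF cut_edges_inj]) (simp add: split_def)
  also have "\<dots> = (\<Sum>x\<in>S. \<Sum>y\<in>{..<n} - S. c {x, y})"
    by (rule sum.cartesian_product[symmetric])
  also have "\<dots> = (\<Sum>x\<in>S. \<Sum>y\<in>{..<n} - S. conductance c x y)"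
    by (intro sum.cong refl) (auto simp: conductance_def)
  finally show ?thesis .
qed

lemma sum_conductance_eq_cut:
  assumes "u < n"
  shows "(\<Sum>y<n. conductance c u y) = (\<Sum>e\<in>cut_edges n {u}. c e)"
proof -
  have "(\<Sum>y<n. conductance c u y) = conductance c u u + (\<Sum>y\<in>{..<n} - {u}. conductance c u y)"
    using assms by (intro sum.remove) auto
  then show ?thesis using assms by (simp add: sum_cut_edges) (simp add: conductance_def)
qed

lemma card_complete_edges: "real (card (complete_edges n)) = n * (real n - 1) / 2"
proof -
  have "card (complete_edges n) = n choose 2"
    using n_subsets[of "{..<n}" 2] by (simp add: complete_edges_def)
  then show ?thesis
    by (cases n) (auto simp: choose_two real_of_nat_div field_simps)
qed

abbreviation uniform01 :: "real measure" where
  "uniform01 \<equiv> uniform_measure lborel {0..1}"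

text \<open>The mean of \<open>exp (- b * U)\<close> for \<open>U\<close> uniform on the unit interval. As the square of a weight is the
  weight at inverse temperature \<open>2 * b\<close>, it also describes second moments.\<close>

definition mean_weight :: "real \<Rightarrow> real" where
  "mean_weight b = (1 - exp (- b)) / b"

lemma prob_space_uniform01: "prob_space uniform01"
  by (intro prob_space_uniform_measure) auto

lemma borel_measurable_uniform01:
  "f \<in> borel_measurable borel \<Longrightarrow> f \<in> borel_measurable uniform01"
  by (simp cong: measurable_cong_sets)

lemma AE_uniform01: "AE x in uniform01. 0 \<le> x \<and> x \<le> 1"
  by (rule AE_uniform_measureI) auto

lemma integral_exp_uniform01:
  assumes "b > 0"
  shows "(\<integral>x. exp (- b * x) \<partial>uniform01) = mean_weight b"
proof -
  have U: "uniform01 = density lborel (\<lambda>x. ennreal (indicator {0..1} x))"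
    by (simp add: uniform_measure_def ennreal_indicator divide_ennreal_def)
  have "(\<integral>x. exp (- b * x) \<partial>uniform01) = (\<integral>x. exp (- b * x) * indicator {0..1} x \<partial>lborel)"
    unfolding U by (subst integral_density) (auto simp: mult.commute)
  also have "\<dots> = (- exp (- b * 1) / b) - (- exp (- b * 0) / b)"
  proof (rule integral_FTC_Icc_real)
    show "DERIV (\<lambda>x. - exp (- b * x) / b) x :> exp (- b * x)" for x
      using assms by (auto intro!: derivative_eq_intros)
  qed (auto intro!: continuous_intros)
  also have "\<dots> = mean_weight b" by (simp add: mean_weight_def diff_divide_distrib)
  finally show ?thesis .
qed

lemma exp_le_quadratic:
  fixes y :: real
  assumes "\<bar>y\<bar> \<le> 1"
  shows "exp y \<le> 1 + y + y\<^sup>2"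
proof (cases "0 \<le> y")
  case True
  then show ?thesis using exp_bound[of y] assms by simp
next
  case False
  define z where "z = - y"
  have z: "0 < z" using False by (simp add: z_def)
  have "(1 + z) * (1 - z + z\<^sup>2) = 1 + z ^ 3" by (simp add: algebra_simps power2_eq_square power3_eq_cube)
  then have "1 \<le> (1 + z) * (1 - z + z\<^sup>2)" using z by simp
  then have "1 / (1 + z) \<le> 1 - z + z\<^sup>2" using z by (simp add: divide_le_eq mult.commute)
  moreover have "exp y \<le> 1 / (1 + z)"
    using exp_ge_add_one_self[of z] z by (simp add: z_def exp_minus field_simps)
  ultimately show ?thesis by (simp add: z_def)
qed

text \<open>For \<open>t\<close> in the unit interval, \<open>t\<^sup>2 \<le> t\<close> turns the quadratic bound on the exponential into one that is
  linear in \<open>t\<close>. So the second-order term is governed by the mean as well, which may be as small as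
  \<open>1 / b\<close>.\<close>

lemma exp_moment_weight:
  fixes l :: real
  assumes b: "b > 0" and l: "\<bar>l\<bar> \<le> 1"
  shows "integrable uniform01 (\<lambda>x. exp (l * exp (- b * x)))"
    and "(\<integral>x. exp (l * exp (- b * x)) \<partial>uniform01) \<le> exp ((l + l\<^sup>2) * mean_weight b)"
proof -
  interpret prob_space uniform01 by (rule prob_space_uniform01)
  have w: "AE x in uniform01. 0 \<le> exp (- b * x) \<and> exp (- b * x) \<le> 1"
    using AE_uniform01 b by (auto elim!: AE_mp)
  have int1: "integrable uniform01 (\<lambda>x. exp (- b * x))"
    by (rule integrable_const_bound[where B = 1])
      (use w in \<open>auto intro!: borel_measurable_uniform01\<close>)
  have "AE x in uniform01. exp (l * exp (- b * x)) \<le> 1 + (l + l\<^sup>2) * exp (- b * x)"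
    using w
  proof (rule AE_mp, intro AE_I2 impI)
    fix x assume "0 \<le> exp (- b * x) \<and> exp (- b * x) \<le> 1"
    then obtain t where t: "t = exp (- b * x)" "0 \<le> t" "t \<le> 1" by blast
    have "\<bar>l * t\<bar> \<le> 1 * 1" unfolding abs_mult using l t by (intro mult_mono) auto
    then have "exp (l * t) \<le> 1 + l * t + (l * t)\<^sup>2" by (intro exp_le_quadratic) simp
    also have "(l * t)\<^sup>2 \<le> l\<^sup>2 * t"
      using t mult_left_mono[of "t * t" t "l\<^sup>2"] by (simp add: power2_eq_square mult_left_le mult_ac)
    finally show "exp (l * exp (- b * x)) \<le> 1 + (l + l\<^sup>2) * exp (- b * x)"
      by (simp add: t(1) algebra_simps)
  qed
  moreover have "AE x in uniform01. norm (exp (l * exp (- b * x))) \<le> exp \<bar>l\<bar>"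
    using w
  proof (rule AE_mp, intro AE_I2 impI)
    fix x assume w: "0 \<le> exp (- b * x) \<and> exp (- b * x) \<le> 1"
    have "l * exp (- b * x) \<le> \<bar>l\<bar> * 1"
      using w by (intro mult_mono) auto
    then show "norm (exp (l * exp (- b * x))) \<le> exp \<bar>l\<bar>" by simp
  qed
  then show int: "integrable uniform01 (\<lambda>x. exp (l * exp (- b * x)))"
    by (intro integrable_const_bound[where B = "exp \<bar>l\<bar>"]) (auto intro!: borel_measurable_uniform01)
  ultimately have "(\<integral>x. exp (l * exp (- b * x)) \<partial>uniform01) \<le> (\<integral>x. 1 + (l + l\<^sup>2) * exp (- b * x) \<partial>uniform01)"
    using int1 by (intro integral_mono_AE) auto
  also have "\<dots> = 1 + (l + l\<^sup>2) * mean_weight b"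
    using int1 by (simp add: integral_exp_uniform01[OF b, simplified] prob_space[simplified])
  also have "\<dots> \<le> exp ((l + l\<^sup>2) * mean_weight b)" by (rule exp_ge_add_one_self)
  finally show "(\<integral>x. exp (l * exp (- b * x)) \<partial>uniform01) \<le> exp ((l + l\<^sup>2) * mean_weight b)" .
qed

lemma env_exp_moment:
  fixes l :: real
  assumes b: "b > 0" and l: "\<bar>l\<bar> \<le> 1" and A: "A \<subseteq> complete_edges n"
  shows "integrable (env_measure n) (\<lambda>\<omega>. exp (l * (\<Sum>e\<in>A. exp (- b * \<omega> e))))"
    and "(\<integral>\<omega>. exp (l * (\<Sum>e\<in>A. exp (- b * \<omega> e))) \<partial>env_measure n) \<le>
      exp ((l + l\<^sup>2) * (card A * mean_weight b))"
proof -
  interpret product_sigma_finite "\<lambda>_. uniform01"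
    by (intro product_sigma_finite.intro prob_space_imp_sigma_finite prob_space_uniform01)
  define f where "f e x = (if e \<in> A then exp (l * exp (- b * x)) else 1)" for e :: "nat set" and x :: real
  have finA: "finite A" using A finite_complete_edges finite_subset by blast
  have prod: "exp (l * (\<Sum>e\<in>A. exp (- b * \<omega> e))) = (\<Prod>e\<in>complete_edges n. f e (\<omega> e))" for \<omega>
  proof -
    have "(\<Prod>e\<in>complete_edges n. f e (\<omega> e)) = (\<Prod>e\<in>A. f e (\<omega> e))"
      using A finite_complete_edges by (intro prod.mono_neutral_right) (auto simp: f_def)
    also have "\<dots> = (\<Prod>e\<in>A. exp (l * exp (- b * \<omega> e)))" by (simp add: f_def)
    finally show ?thesis using finA by (simp add: sum_distrib_left exp_sum)
  qed
  have int: "integrable uniform01 (f e)" for e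
    using exp_moment_weight(1)[OF b l]
      finite_measure.integrable_const[OF prob_space.finite_measure[OF prob_space_uniform01]]
    by (cases "e \<in> A") (simp_all add: f_def[abs_def])
  show "integrable (env_measure n) (\<lambda>\<omega>. exp (l * (\<Sum>e\<in>A. exp (- b * \<omega> e))))"
    unfolding prod env_measure_def using finite_complete_edges int by (rule product_integrable_prod)
  have "(\<integral>\<omega>. exp (l * (\<Sum>e\<in>A. exp (- b * \<omega> e))) \<partial>env_measure n) =
      (\<Prod>e\<in>complete_edges n. \<integral>x. f e x \<partial>uniform01)"
    unfolding prod env_measure_def using finite_complete_edges int by (rule product_integral_prod)
  also have "\<dots> = (\<Prod>e\<in>A. \<integral>x. f e x \<partial>uniform01)"
    using A finite_complete_edges
    by (intro prod.mono_neutral_right)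
      (auto simp: f_def[abs_def] prob_space.prob_space[OF prob_space_uniform01, simplified])
  also have "\<dots> = (\<integral>x. exp (l * exp (- b * x)) \<partial>uniform01) ^ card A" by (simp add: f_def[abs_def])
  also have "\<dots> \<le> exp ((l + l\<^sup>2) * mean_weight b) ^ card A"
    by (intro power_mono exp_moment_weight(2)[OF b l] integral_nonneg_AE) auto
  also have "\<dots> = exp ((l + l\<^sup>2) * (card A * mean_weight b))"
    by (simp add: exp_of_nat_mult[symmetric] mult_ac)
  finally show "(\<integral>\<omega>. exp (l * (\<Sum>e\<in>A. exp (- b * \<omega> e))) \<partial>env_measure n) \<le>
      exp ((l + l\<^sup>2) * (card A * mean_weight b))" .
qed

lemma measurable_sum_weights:
  assumes "A \<subseteq> complete_edges n"
  shows "(\<lambda>\<omega>. \<Sum>e\<in>A. exp (- b * \<omega> e)) \<in> borel_measurable (env_measure n)"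
proof (rule borel_measurable_sum)
  fix e assume "e \<in> A"
  then have [measurable]: "(\<lambda>\<omega>. \<omega> e) \<in> borel_measurable (env_measure n)"
    using assms by (intro measurable_env_component) auto
  show "(\<lambda>\<omega>. exp (- b * \<omega> e)) \<in> borel_measurable (env_measure n)" by measurable
qed

text \<open>Chernoff bound for both tails, the sign \<open>s\<close> selecting the tail. The exponent is proportional to the
  mean of the sum, not just to the number of edges; this is what allows \<open>\<beta>\<close> to be almost of order
  \<open>n / ln n\<close>.\<close>

lemma weight_deviation:
  fixes s \<epsilon> :: real
  assumes b: "b > 0" and s: "s = 1 \<or> s = - 1" and \<epsilon>: "0 < \<epsilon>" "\<epsilon> \<le> 1" and A: "A \<subseteq> complete_edges n"
  defines "m \<equiv> card A * mean_weight b"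
  shows "measure (env_measure n) {\<omega> \<in> space (env_measure n).
      \<epsilon> * m \<le> s * ((\<Sum>e\<in>A. exp (- b * \<omega> e)) - m)} \<le> exp (- (m * \<epsilon>\<^sup>2 / 4))"
proof -
  \<comment> \<open>the minimizer over \<open>l\<close> of the exponent \<open>m * (l\<^sup>2 - s * \<epsilon> * l)\<close>\<close>
  define l where "l = s * \<epsilon> / 2"
  define X where "X \<omega> = (\<Sum>e\<in>A. exp (- b * \<omega> e))" for \<omega> :: "nat set \<Rightarrow> real"
  have s2: "s * s = 1" using s by auto
  have l: "\<bar>l\<bar> \<le> 1" using s \<epsilon> by (auto simp: l_def)
  have l2: "l\<^sup>2 = \<epsilon>\<^sup>2 / 4" using s by (auto simp: l_def power2_eq_square)
  let ?a = "exp (l * m + \<epsilon>\<^sup>2 / 2 * m)"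
  have "{\<omega> \<in> space (env_measure n). \<epsilon> * m \<le> s * (X \<omega> - m)} =
    {\<omega> \<in> space (env_measure n). exp (l * X \<omega>) \<ge> ?a}"
  proof (intro Collect_cong conj_cong refl)
    fix \<omega>
    have "\<epsilon> * m \<le> s * (X \<omega> - m) \<longleftrightarrow> (\<epsilon> / 2) * (\<epsilon> * m) \<le> (\<epsilon> / 2) * (s * (X \<omega> - m))"
      using \<epsilon> by simp
    also have "\<dots> \<longleftrightarrow> l * m + \<epsilon>\<^sup>2 / 2 * m \<le> l * X \<omega>"
      by (simp add: l_def algebra_simps power2_eq_square)
    finally show "\<epsilon> * m \<le> s * (X \<omega> - m) \<longleftrightarrow> exp (l * X \<omega>) \<ge> ?a" by simp
  qed
  also have "measure (env_measure n) \<dots> \<le> (\<integral>\<omega>. exp (l * X \<omega>) \<partial>env_measure n) / ?a"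
    using env_exp_moment(1)[OF b l A] unfolding X_def
    by (intro integral_Markov_inequality_measure[where A = "{}"]) auto
  also have "\<dots> \<le> exp ((l + l\<^sup>2) * m) / ?a"
    using env_exp_moment(2)[OF b l A] unfolding X_def m_def by (intro divide_right_mono) auto
  also have "\<dots> = exp (- (m * \<epsilon>\<^sup>2 / 4))"
    unfolding exp_diff[symmetric] l2[symmetric]
    by (simp add: l2 algebra_simps)
  finally show ?thesis by (simp add: X_def)
qed

lemma mean_weight_bounds:
  assumes "b > 0"
  shows "0 < mean_weight b" "1 / (1 + b) \<le> mean_weight b" "mean_weight b \<le> 2 * mean_weight (2 * b)"
proof -
  show "0 < mean_weight b" using assms by (simp add: mean_weight_def)
  have "exp (- b) \<le> 1 / (1 + b)"
    using exp_ge_add_one_self[of b] assms by (simp add: exp_minus field_simps)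
  then have "b / (1 + b) \<le> 1 - exp (- b)" using assms by (simp add: field_simps)
  then show "1 / (1 + b) \<le> mean_weight b" using assms by (simp add: mean_weight_def field_simps)
  have "exp (- (2 * b)) \<le> exp (- b)" using assms by simp
  then have "(1 - exp (- b)) / b \<le> (1 - exp (- (2 * b))) / b"
    using assms by (intro divide_right_mono) auto
  also have "\<dots> = 2 * mean_weight (2 * b)" using assms by (simp add: mean_weight_def field_simps)
  finally show "mean_weight b \<le> 2 * mean_weight (2 * b)" by (simp add: mean_weight_def)
qed

section \<open>Weak disorder\<close>

lemma sum_subsets_power:
  fixes y :: real
  assumes "finite A"
  shows "(\<Sum>S\<in>Pow A. y ^ card S) = (1 + y) ^ card A"
  using prod_add[OF assms, of "\<lambda>_. y" "\<lambda>_. 1"] by (simp add: add.commute)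

text \<open>Union bound over the events that some vertex has a large degree, that some set of at most half of
  the vertices has a cut of less than half its mean, or that one of the two global sums deviates. A cut
  of a set of size \<open>k\<close> fails with probability at most \<open>y ^ k\<close>, where \<open>y \<le> 1 / n\<^sup>2\<close>; this beats the number
  of sets of that size, the sum over all nonempty sets being at most \<open>(1 + y) ^ n - 1\<close>.\<close>

lemma near_uniform_prob:
  fixes b \<epsilon> :: real
  assumes n: "n \<ge> 2" and b: "b > 0" and \<epsilon>: "0 < \<epsilon>" "\<epsilon> \<le> 1 / 4"
    and large: "1 \<le> \<epsilon> * (n * mean_weight b)" "1 \<le> \<epsilon> * n"
      "2 * ln n \<le> n * mean_weight b * (\<epsilon>\<^sup>2 / 32)"
  shows "1 - (1 / n + (exp (1 / n) - 1) + 3 / (real n)\<^sup>2) \<le>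
    measure (env_measure n) {\<omega> \<in> space (env_measure n).
      \<bar>expected_overlap n b \<omega> / (b * ((1 - exp (- 2 * b)) / (1 - exp (- b))\<^sup>2)) - 1\<bar> \<le> 400 * \<epsilon>}"
proof -
  interpret prob_space "env_measure n" by (rule prob_space_env_measure)
  let ?M = "env_measure n" and ?E = "complete_edges n"
  define \<mu> \<mu>2 where "\<mu> = mean_weight b" and "\<mu>2 = mean_weight (2 * b)"
  note \<mu> = mean_weight_bounds[OF b, folded \<mu>_def \<mu>2_def]
  have \<mu>2: "0 < \<mu>2" using mean_weight_bounds(1)[of "2 * b"] b by (simp add: \<mu>2_def)
  \<comment> \<open>a common bound on all failure probabilities except those of cuts, which are powers of it\<close>
  define y where "y = exp (- (n * \<mu> * (\<epsilon>\<^sup>2 / 32)))"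
  have y: "0 \<le> y" "y \<le> 1 / (real n)\<^sup>2"
  proof -
    show "0 \<le> y" by (simp add: y_def)
    have "y \<le> exp (- (2 * ln n))" using large(3) by (simp add: y_def \<mu>_def)
    also have "\<dots> = 1 / (exp (ln n))\<^sup>2" by (simp add: exp_minus exp_double[symmetric] inverse_eq_divide)
    also have "\<dots> = 1 / (real n)\<^sup>2" using n by simp
    finally show "y \<le> 1 / (real n)\<^sup>2" .
  qed
  define dev where "dev a s \<eta> A = {\<omega> \<in> space ?M. \<eta> * (card A * mean_weight a) \<le>
    s * ((\<Sum>e\<in>A. exp (- a * \<omega> e)) - card A * mean_weight a)}" for a s \<eta> :: real and A :: "nat set set"
  have dev_sets: "dev a s \<eta> A \<in> events" if "A \<subseteq> ?E" for a s \<eta> A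
  proof -
    note measurable_sum_weights[OF that, of a, measurable]
    show ?thesis unfolding dev_def by measurable
  qed
  have dev_le: "prob (dev a s \<eta> A) \<le> exp (- (t * (\<eta>\<^sup>2 / 4)))"
    if "a > 0" "s = 1 \<or> s = - 1" "0 < \<eta>" "\<eta> \<le> 1" "A \<subseteq> ?E" "t \<le> card A * mean_weight a" for a s \<eta> A t
  proof -
    have "prob (dev a s \<eta> A) \<le> exp (- (card A * mean_weight a * \<eta>\<^sup>2 / 4))"
      unfolding dev_def by (rule weight_deviation[OF that(1-5)])
    also have "\<dots> \<le> exp (- (t * (\<eta>\<^sup>2 / 4)))"
      using mult_right_mono[OF that(6), of "\<eta>\<^sup>2 / 4"] by simp
    finally show ?thesis .
  qed
  have n1: "real n / 2 \<le> real n - 1" using n by simp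
  have nE: "real n / 2 \<le> n * (real n - 1) / 2"
    using n mult_left_mono[of 1 "real n - 1" "real n"] by simp
  define P where "P = {S. S \<subseteq> {..<n} \<and> S \<noteq> {} \<and> 2 * card S \<le> n}"
  have P: "P \<subseteq> Pow {..<n} - {{}}" "finite P"
    unfolding P_def by (auto intro: finite_subset[of _ "Pow {..<n}"])
  define B1 where "B1 = (\<Union>u\<in>{..<n}. dev b 1 \<epsilon> (cut_edges n {u}))"
  define B2 where "B2 = (\<Union>S\<in>P. dev b (- 1) (1 / 2) (cut_edges n S))"
  define B3 where "B3 = dev b (- 1) \<epsilon> ?E"
  define B4 where "B4 = dev (2 * b) (- 1) \<epsilon> ?E"
  define B5 where "B5 = dev (2 * b) 1 \<epsilon> ?E"
  have cut_sub: "cut_edges n S \<subseteq> ?E" if "S \<in> P \<or> (\<exists>u<n. S = {u})" for S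
    using that by (intro cut_edges_subset) (auto simp: P_def)
  have sets: "B1 \<in> events" "B2 \<in> events" "B3 \<in> events" "B4 \<in> events" "B5 \<in> events"
    using P(2) by (auto simp: B1_def B2_def B3_def B4_def B5_def intro!: dev_sets cut_sub sets.finite_UN)
  have p1: "prob B1 \<le> 1 / n"
  proof -
    have "prob B1 \<le> (\<Sum>u<n. prob (dev b 1 \<epsilon> (cut_edges n {u})))"
      unfolding B1_def using dev_sets cut_sub by (intro finite_measure_subadditive_finite) auto
    also have "\<dots> \<le> (\<Sum>u<n. y)"
    proof (intro sum_mono)
      fix u assume u: "u \<in> {..<n}"
      have "n * \<mu> / 8 \<le> (real n - 1) * \<mu>"
        using mult_right_mono[OF n1, of \<mu>] \<mu>(1) by simp
      also have "\<dots> = card (cut_edges n {u}) * mean_weight b"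
        using u n by (simp add: card_cut_edges \<mu>_def of_nat_diff)
      finally have "prob (dev b 1 \<epsilon> (cut_edges n {u})) \<le> exp (- (n * \<mu> / 8 * (\<epsilon>\<^sup>2 / 4)))"
        using u \<epsilon> b cut_sub by (intro dev_le) auto
      then show "prob (dev b 1 \<epsilon> (cut_edges n {u})) \<le> y" by (simp add: y_def)
    qed
    also have "\<dots> \<le> n * (1 / (real n)\<^sup>2)" using mult_left_mono[OF y(2), of "real n"] by simp
    also have "\<dots> = 1 / n" by (simp add: power2_eq_square)
    finally show ?thesis .
  qed
  have p2: "prob B2 \<le> exp (1 / n) - 1"
  proof -
    have "prob B2 \<le> (\<Sum>S\<in>P. prob (dev b (- 1) (1 / 2) (cut_edges n S)))"
      unfolding B2_def using dev_sets cut_sub P(2) by (intro finite_measure_subadditive_finite) auto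
    also have "\<dots> \<le> (\<Sum>S\<in>P. y ^ card S)"
    proof (intro sum_mono)
      fix S assume S: "S \<in> P"
      have half: "real n / 2 \<le> real (n - card S)" and le: "card S \<le> n" using S by (auto simp: P_def)
      have "card S * (n * \<mu> / 2) \<le> card S * (n - card S) * \<mu>"
        using mult_right_mono[OF mult_left_mono[OF half, of "card S"], of \<mu>] \<mu>(1) by simp
      also have "\<dots> = card (cut_edges n S) * mean_weight b"
        using S by (simp add: card_cut_edges P_def \<mu>_def)
      finally have "prob (dev b (- 1) (1 / 2) (cut_edges n S)) \<le>
          exp (- (card S * (n * \<mu> / 2) * ((1 / 2)\<^sup>2 / 4)))"
        using S b cut_sub by (intro dev_le) auto
      also have "\<dots> = exp (- (card S * (n * \<mu> / 32)))" by (simp add: power2_eq_square)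
      also have "\<dots> \<le> exp (- (card S * (n * \<mu> * (\<epsilon>\<^sup>2 / 32))))"
      proof -
        have "\<epsilon>\<^sup>2 \<le> 1" using \<epsilon> by (simp add: power_le_one)
        then have "n * \<mu> * (\<epsilon>\<^sup>2 / 32) \<le> n * \<mu> * (1 / 32)" using \<mu>(1) by (intro mult_left_mono) auto
        then show ?thesis by (simp add: mult_left_mono)
      qed
      also have "\<dots> = y ^ card S" by (simp add: y_def exp_of_nat_mult[symmetric])
      finally show "prob (dev b (- 1) (1 / 2) (cut_edges n S)) \<le> y ^ card S" .
    qed
    also have "\<dots> \<le> (\<Sum>S\<in>Pow {..<n} - {{}}. y ^ card S)"
      using P y by (intro sum_mono2) auto
    also have "\<dots> = (1 + y) ^ n - 1"
      using sum_subsets_power[of "{..<n}" y] by (subst sum_diff1) auto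
    also have "(1 + y) ^ n \<le> exp y ^ n" using y by (intro power_mono) auto
    also have "exp y ^ n = exp (n * y)" by (simp add: exp_of_nat_mult)
    also have "n * y \<le> n * (1 / (real n)\<^sup>2)" using y by (intro mult_left_mono) auto
    also have "\<dots> = 1 / n" by (simp add: power2_eq_square)
    finally show ?thesis by simp
  qed
  have cardE: "n * \<mu> / 2 \<le> card ?E * mean_weight b" "n * \<mu> / 4 \<le> card ?E * mean_weight (2 * b)"
  proof -
    show "n * \<mu> / 2 \<le> card ?E * mean_weight b"
      using mult_right_mono[OF nE, of \<mu>] \<mu>(1) by (simp add: card_complete_edges \<mu>_def)
    have "n * \<mu> / 4 \<le> n / 2 * \<mu>2" using mult_left_mono[OF \<mu>(3), of "real n / 4"] by (simp add: algebra_simps)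
    also have "\<dots> \<le> card ?E * mean_weight (2 * b)"
      using mult_right_mono[OF nE, of \<mu>2] \<mu>2 by (simp add: card_complete_edges \<mu>2_def)
    finally show "n * \<mu> / 4 \<le> card ?E * mean_weight (2 * b)" .
  qed
  have p345: "prob B3 \<le> y" "prob B4 \<le> y" "prob B5 \<le> y"
  proof -
    have y_eq: "exp (- (n * \<mu> / 8 * (\<epsilon>\<^sup>2 / 4))) = y" by (simp add: y_def)
    have nonneg: "0 \<le> n * \<mu>" using \<mu>(1) by simp
    show "prob B3 \<le> y" unfolding B3_def y_eq[symmetric] using cardE nonneg b \<epsilon> by (intro dev_le) auto
    show "prob B4 \<le> y" unfolding B4_def y_eq[symmetric] using cardE nonneg b \<epsilon> by (intro dev_le) auto
    show "prob B5 \<le> y" unfolding B5_def y_eq[symmetric] using cardE nonneg b \<epsilon> by (intro dev_le) auto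
  qed
  define G where "G = {\<omega> \<in> space ?M.
      \<bar>expected_overlap n b \<omega> / (b * ((1 - exp (- 2 * b)) / (1 - exp (- b))\<^sup>2)) - 1\<bar> \<le> 400 * \<epsilon>}"
  have G: "G \<in> events"
  proof -
    note measurable_expected_overlap[of n b, measurable]
    show ?thesis unfolding G_def by measurable
  qed
  let ?B = "B1 \<union> B2 \<union> B3 \<union> B4 \<union> B5"
  have good: "\<omega> \<in> G" if \<omega>: "\<omega> \<in> space ?M" "\<omega> \<notin> ?B" and unit: "\<forall>e\<in>?E. 0 \<le> \<omega> e" for \<omega>
  proof -
    define c where "c e = exp (- b * \<omega> e)" for e
    have dev_iff: "\<omega> \<in> dev a s \<eta> A \<longleftrightarrow> \<eta> * (card A * mean_weight a) \<le>
       s * ((\<Sum>e\<in>A. exp (- a * \<omega> e)) - card A * mean_weight a)" for a s \<eta> A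
      using \<omega>(1) by (simp add: dev_def)
    have c2: "(c e)\<^sup>2 = exp (- (2 * b) * \<omega> e)" for e
      by (simp add: c_def exp_double[symmetric] mult.assoc)
    have "\<bar>(\<Sum>e\<in>?E. (edge_prob n c e)\<^sup>2) / (2 * \<mu>2 / \<mu>\<^sup>2) - 1\<bar> \<le> 400 * \<epsilon>"
    proof (rule sum_squares_edge_prob_near_uniform)
      show "0 < c e" for e by (simp add: c_def)
      show "c e \<le> 1" if "e \<in> ?E" for e using unit that b by (simp add: c_def)
      show "(\<Sum>z<n. conductance c x z) \<le> (1 + \<epsilon>) * (n * \<mu>)" if x: "x < n" for x
      proof -
        have "\<omega> \<notin> dev b 1 \<epsilon> (cut_edges n {x})" using \<omega>(2) x by (auto simp: B1_def)
        then have "(\<Sum>e\<in>cut_edges n {x}. c e) \<le> (1 + \<epsilon>) * ((real n - 1) * \<mu>)"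
          using x n by (simp add: dev_iff c_def card_cut_edges \<mu>_def of_nat_diff algebra_simps)
        also have "\<dots> \<le> (1 + \<epsilon>) * (n * \<mu>)"
          using \<epsilon> \<mu>(1) by (intro mult_left_mono mult_right_mono) auto
        finally show ?thesis using x by (simp add: sum_conductance_eq_cut)
      qed
      show "n * \<mu> / 4 * real (card S) \<le> (\<Sum>x\<in>S. \<Sum>y\<in>{..<n} - S. conductance c x y)"
        if S: "S \<subseteq> {..<n}" "2 * card S \<le> n" for S
      proof (cases "S = {}")
        case False
        with S have "S \<in> P" by (simp add: P_def)
        then have "\<omega> \<notin> dev b (- 1) (1 / 2) (cut_edges n S)" using \<omega>(2) by (auto simp: B2_def)
        then have "\<not> 1 / 2 * (card (cut_edges n S) * \<mu>) \<le>
            - 1 * ((\<Sum>e\<in>cut_edges n S. c e) - card (cut_edges n S) * \<mu>)"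
          by (simp only: dev_iff c_def \<mu>_def not_False_eq_True)
        then have "1 / 2 * (card (cut_edges n S) * \<mu>) \<le> (\<Sum>e\<in>cut_edges n S. c e)"
          by (simp add: algebra_simps)
        moreover have "real n * card S \<le> 2 * real (card (cut_edges n S))"
        proof -
          have "n \<le> 2 * (n - card S)" using S by linarith
          then have "n * card S \<le> 2 * (n - card S) * card S" by (rule mult_le_mono1)
          also have "\<dots> = 2 * card (cut_edges n S)" using S by (simp add: card_cut_edges)
          finally have "real (n * card S) \<le> real (2 * card (cut_edges n S))" by (rule of_nat_mono)
          then show ?thesis by simp
        qed
        then have "real n * card S * \<mu> \<le> 2 * real (card (cut_edges n S)) * \<mu>"
          using \<mu>(1) by (intro mult_right_mono) auto
        ultimately have "real n * card S * \<mu> / 4 \<le> (\<Sum>e\<in>cut_edges n S. c e)" by linarith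
        then show ?thesis using S by (simp add: sum_cut_edges mult_ac)
      qed simp
      have "\<omega> \<notin> B3" "\<omega> \<notin> B4" "\<omega> \<notin> B5" using \<omega>(2) by auto
      then have dev3:
        "\<not> \<epsilon> * (n * (real n - 1) / 2 * \<mu>) \<le> - 1 * ((\<Sum>e\<in>?E. c e) - n * (real n - 1) / 2 * \<mu>)"
        "\<not> \<epsilon> * (n * (real n - 1) / 2 * \<mu>2) \<le> - 1 * ((\<Sum>e\<in>?E. (c e)\<^sup>2) - n * (real n - 1) / 2 * \<mu>2)"
        "\<not> \<epsilon> * (n * (real n - 1) / 2 * \<mu>2) \<le> 1 * ((\<Sum>e\<in>?E. (c e)\<^sup>2) - n * (real n - 1) / 2 * \<mu>2)"
        unfolding B3_def B4_def B5_def dev_iff c2 card_complete_edges \<mu>_def \<mu>2_def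
        by (simp_all only: c_def not_False_eq_True)
      have low: "(1 - \<eta>) * t \<le> x" if "\<not> \<eta> * t \<le> - 1 * (x - t)" for \<eta> t x :: real
        using that by (simp add: algebra_simps)
      have high: "x \<le> (1 + \<eta>) * t" if "\<not> \<eta> * t \<le> 1 * (x - t)" for \<eta> t x :: real
        using that by (simp add: algebra_simps)
      show "(1 - \<epsilon>) * (n * (real n - 1) / 2 * \<mu>) \<le> (\<Sum>e\<in>?E. c e)" by (rule low[OF dev3(1)])
      show "(1 - \<epsilon>) * (n * (real n - 1) / 2 * \<mu>2) \<le> (\<Sum>e\<in>?E. (c e)\<^sup>2)" by (rule low[OF dev3(2)])
      show "(\<Sum>e\<in>?E. (c e)\<^sup>2) \<le> (1 + \<epsilon>) * (n * (real n - 1) / 2 * \<mu>2)" by (rule high[OF dev3(3)])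
    qed (use n \<epsilon> \<mu> \<mu>2 large in \<open>auto simp: \<mu>_def\<close>)
    moreover have "2 * \<mu>2 / \<mu>\<^sup>2 = b * ((1 - exp (- 2 * b)) / (1 - exp (- b))\<^sup>2)"
    proof -
      have "2 * (x / (2 * b)) / (z / b)\<^sup>2 = b * (x / z\<^sup>2)" for x z :: real
        using b by (cases "z = 0") (auto simp: field_simps power2_eq_square)
      from this[of "1 - exp (- (2 * b))" "1 - exp (- b)"] show ?thesis
        by (simp only: \<mu>_def \<mu>2_def mean_weight_def mult_minus_left)
    qed
    ultimately show ?thesis using \<omega>(1)
      by (simp add: G_def expected_overlap_eq_sum_squares c_def[abs_def])
  qed
  have "AE \<omega> in ?M. \<forall>e\<in>?E. 0 \<le> \<omega> e"
    unfolding env_measure_def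
    by (intro AE_finite_allI finite_complete_edges AE_PiM_component prob_space_uniform01)
      (use AE_uniform01 in \<open>auto elim: AE_mp\<close>)
  then have "AE \<omega> in ?M. \<omega> \<in> space ?M - G \<longrightarrow> \<omega> \<in> ?B"
  proof (rule AE_mp, intro AE_I2 impI)
    fix \<omega> assume "\<forall>e\<in>?E. 0 \<le> \<omega> e" "\<omega> \<in> space ?M - G"
    then show "\<omega> \<in> ?B" using good[of \<omega>] by blast
  qed
  then have "prob (space ?M - G) \<le> prob ?B"
    using sets by (intro finite_measure_mono_AE) auto
  also have "\<dots> \<le> prob B1 + prob B2 + prob B3 + prob B4 + prob B5"
    using sets by (intro order_trans[OF measure_Un_le] add_mono order_refl sets.Un) auto
  also have "\<dots> \<le> 1 / n + (exp (1 / n) - 1) + 3 / (real n)\<^sup>2"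
    using p1 p2 p345 y by simp
  finally show ?thesis using prob_compl[OF G] by (simp add: G_def)
qed

text \<open>A diagonal argument: a bound for each fixed precision yields one with a precision that tends to
  zero slowly enough.\<close>

lemma whp_asympI:
  assumes "\<And>\<epsilon>. 0 < \<epsilon> \<Longrightarrow> (\<lambda>n. measure (env_measure n)
      {\<omega> \<in> space (env_measure n). \<bar>X n \<omega> / a n - 1\<bar> \<le> \<epsilon>}) \<longlonglongrightarrow> 1"
  shows "whp_asymp X a"
proof -
  define p where "p k n = measure (env_measure n)
      {\<omega> \<in> space (env_measure n). \<bar>X n \<omega> / a n - 1\<bar> \<le> 1 / real (Suc k)}" for k n
  have p_le: "p k n \<le> 1" for k n
    unfolding p_def using prob_space.prob_le_1[OF prob_space_env_measure] by blast
  have "\<exists>N. \<forall>n\<ge>N. 1 - 1 / real (Suc k) \<le> p k n" for k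
  proof -
    have "eventually (\<lambda>n. 1 - 1 / real (Suc k) < p k n) sequentially"
      unfolding p_def by (intro order_tendstoD(1)[OF assms]) auto
    then show ?thesis unfolding eventually_sequentially by (meson less_imp_le)
  qed
  then obtain N where N: "\<And>k n. N k \<le> n \<Longrightarrow> 1 - 1 / real (Suc k) \<le> p k n" by metis
  \<comment> \<open>the best precision \<open>1 / (k + 1)\<close> that is already reached at \<open>n\<close>\<close>
  define K where "K n = Max (insert 0 {k. k \<le> n \<and> N k \<le> n})" for n
  have fin: "finite (insert 0 {k. k \<le> n \<and> N k \<le> n})" for n by simp
  have K_ge: "k \<le> K n" if "max k (N k) \<le> n" for k n
    unfolding K_def using that by (intro Max_ge fin) auto
  have K_N: "N (K n) \<le> n" if "N 0 \<le> n" for n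
    using Max_in[OF fin, of n] that unfolding K_def by auto
  have K: "filterlim K at_top sequentially"
    unfolding filterlim_at_top eventually_sequentially using K_ge by blast
  have lim: "(\<lambda>n. 1 / real (Suc (K n))) \<longlonglongrightarrow> 0"
    using filterlim_compose[OF LIMSEQ_inverse_real_of_nat K] by (simp add: inverse_eq_divide)
  have "(\<lambda>n. p (K n) n) \<longlonglongrightarrow> 1"
  proof (rule tendsto_sandwich)
    show "eventually (\<lambda>n. 1 - 1 / real (Suc (K n)) \<le> p (K n) n) sequentially"
      using N K_N by (intro eventually_sequentiallyI[of "N 0"]) blast
    show "(\<lambda>n. 1 - 1 / real (Suc (K n))) \<longlonglongrightarrow> 1" using tendsto_diff[OF tendsto_const lim, of 1] by simp
  qed (use p_le in auto)
  then have "whp (\<lambda>n \<omega>. \<bar>X n \<omega> / a n - 1\<bar> \<le> 1 / real (Suc (K n)))"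
    by (simp add: whp_def p_def)
  with lim show ?thesis unfolding whp_asymp_def by blast
qed

text \<open>The mean \<open>n * mean_weight (\<beta> n)\<close> of a degree eventually exceeds every multiple of \<open>ln n\<close> because \<open>\<beta>\<close>
  is of smaller order than \<open>n / ln n\<close>.\<close>

lemma overlap_high_temperature:
  fixes \<beta> :: "nat \<Rightarrow> real"
  assumes pos: "\<And>n. 0 < \<beta> n" and small: "\<beta> \<in> o(\<lambda>n. real n / ln (real n))"
  shows "whp_asymp (\<lambda>n \<omega>. expected_overlap n (\<beta> n) \<omega>)
     (\<lambda>n. \<beta> n * ((1 - exp (- 2 * \<beta> n)) / (1 - exp (- \<beta> n))\<^sup>2))"
proof (rule whp_asympI)
  fix \<epsilon>0 :: real assume \<epsilon>0: "0 < \<epsilon>0"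
  define \<epsilon> where "\<epsilon> = min (1 / 4) (\<epsilon>0 / 400)"
  have \<epsilon>: "0 < \<epsilon>" "\<epsilon> \<le> 1 / 4" "400 * \<epsilon> \<le> \<epsilon>0" using \<epsilon>0 by (auto simp: \<epsilon>_def)
  have large: "eventually (\<lambda>n. C * ln n \<le> n * mean_weight (\<beta> n)) sequentially" if C: "C > 0" for C :: real
  proof -
    have "eventually (\<lambda>n. norm (\<beta> n) \<le> 1 / (2 * C) * norm (real n / ln (real n))) sequentially"
      using C by (intro landau_o.smallD[OF small]) auto
    moreover have "eventually (\<lambda>n. C * ln (real n) \<le> real n / 2) sequentially" by real_asymp
    moreover have "eventually (\<lambda>n. n \<ge> (3::nat)) sequentially" by (rule eventually_ge_at_top)
    ultimately show ?thesis
    proof eventually_elim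
      case (elim n)
      have ln: "0 < ln (real n)" using elim(3) by simp
      have "\<beta> n \<le> 1 / (2 * C) * (real n / ln (real n))" using elim(1) pos[of n] ln by simp
      then have "C * ln n * \<beta> n \<le> real n / 2" using C ln by (simp add: field_simps)
      with elim(2) have "C * ln n * (1 + \<beta> n) \<le> real n" by (simp add: algebra_simps)
      then have "C * ln n \<le> real n * (1 / (1 + \<beta> n))" using pos[of n] by (simp add: field_simps)
      also have "\<dots> \<le> n * mean_weight (\<beta> n)"
        using mean_weight_bounds(2)[OF pos] by (intro mult_left_mono) auto
      finally show ?case .
    qed
  qed
  let ?p = "\<lambda>n. measure (env_measure n) {\<omega> \<in> space (env_measure n).
      \<bar>expected_overlap n (\<beta> n) \<omega> / (\<beta> n * ((1 - exp (- 2 * \<beta> n)) / (1 - exp (- \<beta> n))\<^sup>2)) - 1\<bar> \<le> \<epsilon>0}"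
  have "eventually (\<lambda>n. 64 / \<epsilon>\<^sup>2 * ln n \<le> n * mean_weight (\<beta> n)) sequentially"
    using \<epsilon> by (intro large) auto
  moreover have "eventually (\<lambda>n. 1 / \<epsilon> * ln n \<le> n * mean_weight (\<beta> n)) sequentially"
    using \<epsilon> by (intro large) auto
  moreover have "eventually (\<lambda>n. 1 / \<epsilon> \<le> real n) sequentially" by real_asymp
  moreover have "eventually (\<lambda>n. n \<ge> (3::nat)) sequentially" by (rule eventually_ge_at_top)
  ultimately have lower: "eventually (\<lambda>n. 1 - (1 / n + (exp (1 / n) - 1) + 3 / (real n)\<^sup>2) \<le> ?p n) sequentially"
  proof eventually_elim
    case (elim n)
    interpret prob_space "env_measure n" by (rule prob_space_env_measure)
    have "1 \<le> ln (real n)"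
      using elim(4) e_less_272 by (subst ln_ge_iff) auto
    then have "1 / \<epsilon> \<le> 1 / \<epsilon> * ln n" using \<epsilon> by (simp add: divide_right_mono)
    also note elim(2)
    finally have "1 - (1 / n + (exp (1 / n) - 1) + 3 / (real n)\<^sup>2) \<le> prob {\<omega> \<in> space (env_measure n).
      \<bar>expected_overlap n (\<beta> n) \<omega> / (\<beta> n * ((1 - exp (- 2 * \<beta> n)) / (1 - exp (- \<beta> n))\<^sup>2)) - 1\<bar> \<le> 400 * \<epsilon>}"
      using elim \<epsilon> pos[of n] by (intro near_uniform_prob) (auto simp: field_simps)
    also have "\<dots> \<le> ?p n"
    proof (rule finite_measure_mono)
      note measurable_expected_overlap[of n "\<beta> n", measurable]
      show "{\<omega> \<in> space (env_measure n).
      \<bar>expected_overlap n (\<beta> n) \<omega> / (\<beta> n * ((1 - exp (- 2 * \<beta> n)) / (1 - exp (- \<beta> n))\<^sup>2)) - 1\<bar> \<le> \<epsilon>0} \<in> events"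
        by measurable
    qed (use \<epsilon>(3) in auto)
    finally show ?case .
  qed
  show "?p \<longlonglongrightarrow> 1"
  proof (rule tendsto_sandwich[OF lower])
    show "(\<lambda>n. 1 - (1 / real n + (exp (1 / real n) - 1) + 3 / (real n)\<^sup>2)) \<longlonglongrightarrow> 1" by real_asymp
    show "eventually (\<lambda>n. ?p n \<le> 1) sequentially"
      using prob_space.prob_le_1[OF prob_space_env_measure] by (intro always_eventually) blast
  qed auto
qed

section \<open>Strong disorder\<close>

definition joins :: "'a set set \<Rightarrow> 'a set \<Rightarrow> bool" where
  "joins F e \<longleftrightarrow> (\<exists>u v. e = {u, v} \<and> linked F u v)"

lemma joins_doubleton: "joins F {u, v} \<longleftrightarrow> linked F u v"
  unfolding joins_def using linked_sym by (metis doubleton_eq_iff)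

lemma joins_mono:
  assumes "joins F e" "F \<subseteq> G"
  shows "joins G e"
proof -
  from assms(1) obtain u v where "e = {u, v}" "linked F u v" by (auto simp: joins_def)
  then show ?thesis using linked_mono[OF _ assms(2)] by (auto simp: joins_def)
qed

text \<open>The least vertices of the components of \<open>F\<close>, so that their number is the number of components.\<close>

definition component_roots :: "nat \<Rightarrow> nat set set \<Rightarrow> nat set" where
  "component_roots n F = {y. y < n \<and> (\<forall>z<y. \<not> linked F z y)}"

lemma component_root_exists:
  assumes "x < n"
  obtains r where "r \<in> component_roots n F" "linked F x r"
proof -
  define r where "r = (LEAST y. linked F x y)"
  have r: "linked F x r" unfolding r_def by (rule LeastI[of _ x]) simp
  have "r \<le> x" unfolding r_def by (rule Least_le) simp
  moreover have "\<not> linked F z r" if "z < r" for z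
  proof
    assume "linked F z r"
    then have "linked F x z" using r by (meson linked_sym linked_trans)
    then have "r \<le> z" unfolding r_def by (rule Least_le)
    with that show False by simp
  qed
  ultimately have "r \<in> component_roots n F" using assms by (simp add: component_roots_def)
  then show ?thesis using r by (rule that)
qed

lemma card_component_roots_insert:
  assumes "u < n" "v < n" "\<not> linked F u v"
  shows "card (component_roots n (insert {u, v} F)) < card (component_roots n F)"
proof (rule psubset_card_mono)
  show "finite (component_roots n F)"
    by (rule finite_subset[of _ "{..<n}"]) (auto simp: component_roots_def)
  let ?G = "insert {u, v} F"
  have sub: "component_roots n ?G \<subseteq> component_roots n F"
    using linked_mono[of F _ _ ?G] by (auto simp: component_roots_def)
  obtain a where a: "a \<in> component_roots n F" "linked F u a" using component_root_exists[OF assms(1)] .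
  obtain b where b: "b \<in> component_roots n F" "linked F v b" using component_root_exists[OF assms(2)] .
  have "a \<noteq> b" using a b assms(3) by (metis linked_sym linked_trans)
  have "linked ?G u v" by (rule linked_edge) simp
  then have ab: "linked ?G a b"
    using linked_mono[OF a(2), of ?G] linked_mono[OF b(2), of ?G]
    by (meson linked_sym linked_trans subset_insertI)
  then have "a \<notin> component_roots n ?G \<or> b \<notin> component_roots n ?G"
    using \<open>a \<noteq> b\<close> linked_sym[OF ab] by (auto simp: component_roots_def linorder_neq_iff)
  with sub a b show "component_roots n ?G \<subset> component_roots n F" by blast
qed

text \<open>Kruskal's count: add the edges in increasing order of \<open>h\<close>. Each of them joins two different
  components of the graph formed by its predecessors, so that their number drops.\<close>

lemma card_forest_le:
  fixes h :: "nat set \<Rightarrow> real"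
  assumes "finite K" "K \<subseteq> complete_edges n"
    and "\<And>e. e \<in> K \<Longrightarrow> \<not> joins {f \<in> K. f \<noteq> e \<and> h f \<le> h e} e"
  shows "card K + card (component_roots n K) \<le> n"
  using assms
proof (induction "card K" arbitrary: K rule: less_induct)
  case less
  show ?case
  proof (cases "K = {}")
    case True
    have "card (component_roots n {}) \<le> card {..<n}"
      by (intro card_mono) (auto simp: component_roots_def)
    then show ?thesis using True by simp
  next
    case False
    define m where "m = Max (h ` K)"
    have "m \<in> h ` K" unfolding m_def using False less.prems(1) by (intro Max_in) auto
    then obtain e where e: "e \<in> K" "h e = m" by blast
    have max: "h f \<le> h e" if "f \<in> K" for f
      unfolding e(2) m_def using that less.prems(1) by (intro Max_ge) auto
    let ?K = "K - {e}"
    obtain u v where uv: "e = {u, v}" "u < n" "v < n"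
      using e(1) less.prems(2) by (blast elim: complete_edgeE)
    have "{f \<in> K. f \<noteq> e \<and> h f \<le> h e} = ?K" using max by auto
    then have "\<not> linked ?K u v" using less.prems(3)[OF e(1)] by (simp add: uv(1) joins_doubleton)
    from card_component_roots_insert[OF uv(2,3) this]
    have "card (component_roots n K) < card (component_roots n ?K)"
      using e(1) by (simp add: uv(1) insert_absorb)
    moreover have "card ?K + card (component_roots n ?K) \<le> n"
    proof (rule less.hyps)
      show "card ?K < card K" using e(1) less.prems(1) by (rule card_Diff1_less[rotated])
      show "\<not> joins {f \<in> ?K. f \<noteq> g \<and> h f \<le> h g} g" if "g \<in> ?K" for g
      proof
        assume "joins {f \<in> ?K. f \<noteq> g \<and> h f \<le> h g} g"
        then have "joins {f \<in> K. f \<noteq> g \<and> h f \<le> h g} g" by (rule joins_mono) auto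
        with less.prems(3)[of g] that show False by simp
      qed
    qed (use less.prems in auto)
    moreover have "card K = Suc (card ?K)" using card_Suc_Diff1[OF less.prems(1) e(1)] by simp
    ultimately show ?thesis by linarith
  qed
qed

definition lighter_edges :: "nat \<Rightarrow> (nat set \<Rightarrow> real) \<Rightarrow> nat set \<Rightarrow> real \<Rightarrow> nat set set" where
  "lighter_edges n \<omega> e s = {f \<in> complete_edges n. f \<noteq> e \<and> \<omega> f \<le> s}"

text \<open>If all values of \<open>\<omega>\<close> are distinct, \<open>\<delta> = 0\<close> gives the minimum spanning tree. A positive \<open>\<delta>\<close> adds those edges that
  are not beaten by a path of edges lighter by at least \<open>\<delta>\<close>.\<close>

definition unjoined_edges :: "nat \<Rightarrow> real \<Rightarrow> (nat set \<Rightarrow> real) \<Rightarrow> nat set set" where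
  "unjoined_edges n \<delta> \<omega> = {e \<in> complete_edges n. \<not> joins (lighter_edges n \<omega> e (\<omega> e - \<delta>)) e}"

lemma finite_unjoined_edges: "finite (unjoined_edges n \<delta> \<omega>)"
  by (simp add: unjoined_edges_def finite_complete_edges)

text \<open>A heaviest edge of a set is compared with all the others by the weak inequality in
  \<open>lighter_edges\<close>, so that the count holds for every environment, even with ties.\<close>

lemma card_unjoined_edges_0:
  assumes "n > 0"
  shows "card (unjoined_edges n 0 \<omega>) \<le> n - 1"
proof -
  let ?K = "unjoined_edges n 0 \<omega>"
  have "\<not> joins {f \<in> ?K. f \<noteq> e \<and> \<omega> f \<le> \<omega> e} e" if "e \<in> ?K" for e
  proof
    assume "joins {f \<in> ?K. f \<noteq> e \<and> \<omega> f \<le> \<omega> e} e"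
    then have "joins (lighter_edges n \<omega> e (\<omega> e - 0)) e"
      by (rule joins_mono) (auto simp: lighter_edges_def unjoined_edges_def)
    with that show False by (simp add: unjoined_edges_def)
  qed
  then have le: "card ?K + card (component_roots n ?K) \<le> n"
    by (intro card_forest_le[where h = \<omega>] finite_unjoined_edges) (auto simp: unjoined_edges_def)
 have "0 \<in> component_roots n ?K" using assms by (simp add: component_roots_def)
  moreover have "finite (component_roots n ?K)" by (simp add: component_roots_def)
  ultimately have "card (component_roots n ?K) > 0" by (auto simp: card_gt_0_iff)
  with le show ?thesis by linarith
qed

text \<open>A path of edges that are lighter by \<open>\<delta>\<close> short-circuits the edge, so that its probability carries the
  factor \<open>exp (- (b * \<delta>))\<close>.\<close>

lemma edge_prob_le_joined:
  assumes b: "b > 0" and e: "e \<in> complete_edges n" "e \<notin> unjoined_edges n \<delta> \<omega>"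
  shows "edge_prob n (\<lambda>e. exp (- b * \<omega> e)) e \<le> real n ^ 4 * exp (- (b * \<delta>))"
proof -
  obtain u v where uv: "e = {u, v}" "u < n" "v < n" using e(1) by (blast elim: complete_edgeE)
  let ?F = "lighter_edges n \<omega> e (\<omega> e - \<delta>)"
  have "linked ?F u v" using e by (simp add: unjoined_edges_def uv(1) joins_doubleton)
  then have "edge_prob n (\<lambda>e. exp (- b * \<omega> e)) {u, v} \<le>
      exp (- b * \<omega> {u, v}) * (real n ^ 4 / exp (- b * (\<omega> e - \<delta>)))"
    using b uv by (intro edge_prob_le_path[where F = ?F]) (auto simp: lighter_edges_def)
  also have "\<dots> = real n ^ 4 * (exp (- b * \<omega> e) / exp (- b * (\<omega> e - \<delta>)))" by (simp add: uv(1))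
  also have "exp (- b * \<omega> e) / exp (- b * (\<omega> e - \<delta>)) = exp (- (b * \<delta>))"
    unfolding exp_diff[symmetric] by (simp add: algebra_simps)
  finally show ?thesis by (simp add: uv(1))
qed

text \<open>Almost all of the total probability \<open>n - 1\<close> sits on the unjoined edges. If there are hardly more than
  \<open>n\<close> of them, the Cauchy-Schwarz inequality forces the sum of squares to be almost \<open>n\<close>.\<close>

lemma overlap_near_n:
  fixes \<eta> \<delta> :: real
  assumes b: "b > 0" and n: "n > 0" and \<eta>: "0 < \<eta>" "\<eta> \<le> 1 / 3" "2 \<le> \<eta> * n"
    and \<delta>: "real n ^ 6 * exp (- (b * \<delta>)) \<le> 1"
    and few: "card (unjoined_edges n \<delta> \<omega>) \<le> (1 + \<eta>) * n"
  shows "\<bar>expected_overlap n b \<omega> / n - 1\<bar> \<le> 3 * \<eta>"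
proof -
  define c where "c e = exp (- b * \<omega> e)" for e
  have c: "0 < c e" for e by (simp add: c_def)
  let ?E = "complete_edges n" and ?p = "edge_prob n c" and ?B = "unjoined_edges n \<delta> \<omega>"
  have sub: "?B \<subseteq> ?E" by (auto simp: unjoined_edges_def)
  have nonneg: "0 \<le> ?p e" for e using edge_prob_nonneg[of c n e] c by simp
  have le1: "?p e \<le> 1" for e using edge_prob_le_1[of c n e] c n by simp
  have total: "(\<Sum>e\<in>?E. ?p e) = real n - 1" using sum_edge_prob[of c n] c n by simp
  have O: "expected_overlap n b \<omega> = (\<Sum>e\<in>?E. (?p e)\<^sup>2)"
    by (simp add: expected_overlap_eq_sum_squares c_def[abs_def])
  have "(\<Sum>e\<in>?E - ?B. ?p e) \<le> (\<Sum>e\<in>?E - ?B. real n ^ 4 * exp (- (b * \<delta>)))"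
    using edge_prob_le_joined[OF b] by (intro sum_mono) (auto simp: c_def[abs_def])
  also have "\<dots> \<le> real (card ?E) * (real n ^ 4 * exp (- (b * \<delta>)))"
    using finite_complete_edges[of n] by (simp add: mult_right_mono card_mono)
  also have "\<dots> \<le> (real n)\<^sup>2 * (real n ^ 4 * exp (- (b * \<delta>)))"
  proof (intro mult_right_mono)
    have "real n * (real n - 1) / 2 \<le> real n * real n" by (simp add: field_simps)
    then show "real (card ?E) \<le> (real n)\<^sup>2" by (simp add: card_complete_edges power2_eq_square)
  qed auto
  also have "\<dots> = real n ^ 6 * exp (- (b * \<delta>))" by (simp add: power_add[symmetric] mult.assoc[symmetric])
  finally have rest: "(\<Sum>e\<in>?E - ?B. ?p e) \<le> 1" using \<delta> by simp
  have "(\<Sum>e\<in>?E. ?p e) = (\<Sum>e\<in>?E - ?B. ?p e) + (\<Sum>e\<in>?B. ?p e)"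
    by (rule sum.subset_diff[OF sub finite_complete_edges])
  then have "(1 - \<eta>) * n \<le> (\<Sum>e\<in>?B. ?p e)" using total rest \<eta>(3) by (simp add: algebra_simps)
  then have "((1 - \<eta>) * n)\<^sup>2 \<le> (\<Sum>e\<in>?B. ?p e)\<^sup>2" using \<eta> by (intro power_mono) auto
  also have "\<dots> = (\<Sum>e\<in>?B. 1 * ?p e)\<^sup>2" by simp
  also have "\<dots> \<le> (\<Sum>e\<in>?B. 1\<^sup>2) * (\<Sum>e\<in>?B. (?p e)\<^sup>2)" by (rule Cauchy_Schwarz_ineq_sum)
  also have "\<dots> \<le> ((1 + \<eta>) * n) * expected_overlap n b \<omega>"
    unfolding O using few sub \<eta>
    by (intro mult_mono sum_mono2 finite_complete_edges) (auto intro: sum_nonneg)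
  finally have "(1 - \<eta>)\<^sup>2 * n * n \<le> (1 + \<eta>) * expected_overlap n b \<omega> * n"
    by (simp add: power_mult_distrib power2_eq_square mult_ac)
  then have "(1 - \<eta>)\<^sup>2 * n \<le> (1 + \<eta>) * expected_overlap n b \<omega>" using n by simp
  moreover have "(1 - 3 * \<eta>) * (1 + \<eta>) * n \<le> (1 - \<eta>)\<^sup>2 * n"
    by (intro mult_right_mono) (auto simp: power2_eq_square algebra_simps)
  ultimately have "(1 + \<eta>) * ((1 - 3 * \<eta>) * n) \<le> (1 + \<eta>) * expected_overlap n b \<omega>"
    by (simp add: mult_ac)
  then have "(1 - 3 * \<eta>) * n \<le> expected_overlap n b \<omega>" using \<eta> by simp
  then have lower: "1 - 3 * \<eta> \<le> expected_overlap n b \<omega> / n" using n by (simp add: pos_le_divide_eq)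
  have "expected_overlap n b \<omega> \<le> (\<Sum>e\<in>?E. ?p e)"
    unfolding O power2_eq_square using nonneg le1 by (intro sum_mono mult_left_le) auto
  then have "expected_overlap n b \<omega> / n \<le> 1" using total n by (simp add: divide_le_eq)
  with lower \<eta> show ?thesis by (simp add: abs_le_iff)
qed

lemma emeasure_uniform01_small_diameter:
  assumes "\<delta> \<ge> 0" "\<And>x y. x \<in> S \<Longrightarrow> y \<in> S \<Longrightarrow> x - y \<le> \<delta>"
  obtains I where "S \<subseteq> I" "I \<in> sets borel" "emeasure uniform01 I \<le> ennreal \<delta>"
proof (cases "S = {}")
  case True
  then show ?thesis using that[of "{}"] by simp
next
  case False
  then obtain x0 where x0: "x0 \<in> S" by blast
  have bdd: "bdd_below S" using assms(2)[OF x0] by (intro bdd_belowI[of _ "x0 - \<delta>"]) force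
  let ?I = "{Inf S..Inf S + \<delta>}"
  have "S \<subseteq> ?I"
  proof
    fix x assume x: "x \<in> S"
    have "x - \<delta> \<le> Inf S" using assms(2)[OF x] False by (intro cInf_greatest) force+
    then show "x \<in> ?I" using cInf_lower[OF x bdd] by simp
  qed
  moreover have "emeasure uniform01 ?I \<le> ennreal \<delta>"
  proof -
    have "emeasure uniform01 ?I = emeasure lborel ({0..1} \<inter> ?I)" by (simp add: divide_ennreal_def)
    also have "\<dots> \<le> emeasure lborel ?I" by (intro emeasure_mono) auto
    also have "\<dots> = ennreal \<delta>" using assms(1) by simp
    finally show ?thesis .
  qed
  ultimately show ?thesis using that[of ?I] by simp
qed

text \<open>Being joined is a finite combination of comparisons between coordinates: some set of edges that
  joins the ends of \<open>e\<close> consists of sufficiently light edges.\<close>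

lemma unjoined_edge_measurable:
  assumes "e \<in> complete_edges n"
  shows "{\<omega> \<in> space (env_measure n). e \<in> unjoined_edges n \<delta> \<omega>} \<in> sets (env_measure n)"
proof -
  let ?M = "env_measure n" and ?E = "complete_edges n"
  have joins_iff: "joins (lighter_edges n \<omega> e s) e \<longleftrightarrow>
      (\<exists>F\<in>{F \<in> Pow ?E. e \<notin> F \<and> joins F e}. \<forall>f\<in>F. \<omega> f \<le> s)" for \<omega> s
  proof
    assume "joins (lighter_edges n \<omega> e s) e"
    then show "\<exists>F\<in>{F \<in> Pow ?E. e \<notin> F \<and> joins F e}. \<forall>f\<in>F. \<omega> f \<le> s"
      by (intro bexI[of _ "lighter_edges n \<omega> e s"]) (auto simp: lighter_edges_def)
  next
    assume "\<exists>F\<in>{F \<in> Pow ?E. e \<notin> F \<and> joins F e}. \<forall>f\<in>F. \<omega> f \<le> s"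
    then obtain F where F: "F \<subseteq> ?E" "e \<notin> F" "joins F e" "\<forall>f\<in>F. \<omega> f \<le> s" by blast
    show "joins (lighter_edges n \<omega> e s) e"
      using F by (intro joins_mono[OF F(3)]) (auto simp: lighter_edges_def)
  qed
  have fin: "finite {F \<in> Pow ?E. e \<notin> F \<and> joins F e}" by (simp add: finite_complete_edges)
  have "{\<omega> \<in> space ?M. \<exists>F\<in>{F \<in> Pow ?E. e \<notin> F \<and> joins F e}. \<forall>f\<in>F. \<omega> f \<le> \<omega> e - \<delta>} \<in> sets ?M"
  proof (rule sets.sets_Collect_finite_Ex[OF _ fin], rule sets.sets_Collect_finite_All')
    fix F f assume F: "F \<in> {F \<in> Pow ?E. e \<notin> F \<and> joins F e}"
    show "finite F" using F finite_complete_edges finite_subset by blast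
    show "{\<omega> \<in> space ?M. \<omega> f \<le> \<omega> e - \<delta>} \<in> sets ?M" if f: "f \<in> F"
    proof -
      have "f \<in> ?E" using F f by blast
      note [measurable] = measurable_env_component[OF this] measurable_env_component[OF assms]
      show ?thesis by measurable
    qed
    obtain u v where "e = {u, v}" "u \<noteq> v" using assms by (blast elim: complete_edgeE)
    then have "\<not> joins {} e" by (auto simp: joins_doubleton elim: linked_leaves[of "{}" u v "{u}"])
    then show "F \<noteq> {}" using F by auto
  qed
  then have "{\<omega> \<in> space ?M. \<not> (\<exists>F\<in>{F \<in> Pow ?E. e \<notin> F \<and> joins F e}. \<forall>f\<in>F. \<omega> f \<le> \<omega> e - \<delta>)} \<in> sets ?M"
    by (rule sets.sets_Collect_neg)
  then show ?thesis using assms by (simp add: unjoined_edges_def joins_iff)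
qed

text \<open>Condition on all coordinates but that of \<open>e\<close>. The levels at which the other edges join the ends of
  \<open>e\<close> form an up-closed set \<open>J\<close>, and the event says that \<open>\<omega> e\<close> lies in \<open>J\<close> while \<open>\<omega> e - \<delta>\<close> does not.
  So \<open>\<omega> e\<close> is confined to an interval of length \<open>\<delta>\<close>.\<close>

lemma prob_newly_unjoined_le:
  assumes e: "e \<in> complete_edges n" and \<delta>: "\<delta> \<ge> 0"
  shows "measure (env_measure n)
    {\<omega> \<in> space (env_measure n). e \<in> unjoined_edges n \<delta> \<omega> - unjoined_edges n 0 \<omega>} \<le> \<delta>"
proof -
  let ?E = "complete_edges n"
  interpret product_sigma_finite "\<lambda>_. uniform01"
    by (intro product_sigma_finite.intro prob_space_imp_sigma_finite prob_space_uniform01)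
  interpret prob_space "env_measure n" by (rule prob_space_env_measure)
  define A where "A = {\<omega> \<in> space (env_measure n). e \<in> unjoined_edges n \<delta> \<omega> - unjoined_edges n 0 \<omega>}"
  have "A = {\<omega> \<in> space (env_measure n). e \<in> unjoined_edges n \<delta> \<omega>} -
      {\<omega> \<in> space (env_measure n). e \<in> unjoined_edges n 0 \<omega>}" by (auto simp: A_def)
  then have A: "A \<in> sets (env_measure n)" using unjoined_edge_measurable[OF e] by auto
  have env: "env_measure n = Pi\<^sub>M (insert e (?E - {e})) (\<lambda>_. uniform01)"
    using e by (simp add: env_measure_def insert_absorb)
  have inner: "(\<integral>\<^sup>+ y. indicator A (x(e := y)) \<partial>uniform01) \<le> ennreal \<delta>" for x
  proof -
    \<comment> \<open>the levels at which the edges other than \<open>e\<close> join its ends\<close>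
    define J where "J = {s. joins (lighter_edges n x e s) e}"
    define S where "S = {y. y \<in> J \<and> y - \<delta> \<notin> J}"
    have up: "t \<in> J" if "s \<in> J" "s \<le> t" for s t
    proof -
      have "lighter_edges n x e s \<subseteq> lighter_edges n x e t" using that(2) by (auto simp: lighter_edges_def)
      with that(1) show ?thesis using joins_mono by (auto simp: J_def)
    qed
    have "y - z \<le> \<delta>" if "y \<in> S" "z \<in> S" for y z
      using that up[of z "y - \<delta>"] by (force simp: S_def)
    from emeasure_uniform01_small_diameter[OF \<delta> this]
    obtain I where I: "S \<subseteq> I" "I \<in> sets borel" "emeasure uniform01 I \<le> ennreal \<delta>" by blast
    have upd: "lighter_edges n (x(e := y)) e s = lighter_edges n x e s" for y s
      by (auto simp: lighter_edges_def)
    have "x(e := y) \<in> A \<Longrightarrow> y \<in> S" for y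
      using e by (auto simp: A_def S_def J_def unjoined_edges_def upd)
    then have "(\<integral>\<^sup>+ y. indicator A (x(e := y)) \<partial>uniform01) \<le> (\<integral>\<^sup>+ y. indicator I y \<partial>uniform01)"
      using I(1) by (intro nn_integral_mono) (auto simp: indicator_def)
    also have "\<dots> = emeasure uniform01 I" using I(2) by (intro nn_integral_indicator) simp
    finally show ?thesis using I(3) by simp
  qed
  have "emeasure (env_measure n) A = (\<integral>\<^sup>+ \<omega>. indicator A \<omega> \<partial>env_measure n)"
    using A by simp
  also have "\<dots> = (\<integral>\<^sup>+ x. (\<integral>\<^sup>+ y. indicator A (x(e := y)) \<partial>uniform01) \<partial>Pi\<^sub>M (?E - {e}) (\<lambda>_. uniform01))"
  proof -
    have "indicator A \<in> borel_measurable (env_measure n)" using A by simp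
    then show ?thesis
      unfolding env using finite_complete_edges by (intro product_nn_integral_insert) simp_all
  qed
  also have "\<dots> \<le> (\<integral>\<^sup>+ x. ennreal \<delta> \<partial>Pi\<^sub>M (?E - {e}) (\<lambda>_. uniform01))"
    by (intro nn_integral_mono inner)
  also have "\<dots> = ennreal \<delta>"
    by (simp add: prob_space.emeasure_space_1[OF prob_space_PiM[OF prob_space_uniform01]])
  finally show ?thesis using \<delta> by (simp add: A_def emeasure_eq_measure)
qed

text \<open>The unjoined edges for \<open>\<delta> = 0\<close> number less than \<open>n\<close>, and the expected number of those added by \<open>\<delta>\<close>
  is at most \<open>n\<^sup>2 * \<delta>\<close>. By Markov's inequality, more than \<open>\<eta> * n\<close> of them are added with probability
  at most \<open>n * \<delta> / \<eta>\<close>.\<close>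

lemma low_temperature_prob:
  fixes b \<eta> \<delta> :: real
  assumes b: "b > 0" and n: "n > 0" and \<eta>: "0 < \<eta>" "\<eta> \<le> 1 / 3" "2 \<le> \<eta> * n"
    and \<delta>: "0 \<le> \<delta>" "real n ^ 6 * exp (- (b * \<delta>)) \<le> 1"
  shows "1 - n * \<delta> / \<eta> \<le> measure (env_measure n)
    {\<omega> \<in> space (env_measure n). \<bar>expected_overlap n b \<omega> / n - 1\<bar> \<le> 3 * \<eta>}"
proof -
  interpret prob_space "env_measure n" by (rule prob_space_env_measure)
  let ?M = "env_measure n" and ?E = "complete_edges n"
  \<comment> \<open>the edge \<open>e\<close> becomes unjoined only because of the slack \<open>\<delta>\<close>\<close>
  define A where "A e = {\<omega> \<in> space ?M. e \<in> unjoined_edges n \<delta> \<omega> - unjoined_edges n 0 \<omega>}" for e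
  have A: "A e \<in> events" if "e \<in> ?E" for e
  proof -
    have "A e = {\<omega> \<in> space ?M. e \<in> unjoined_edges n \<delta> \<omega>} -
      {\<omega> \<in> space ?M. e \<in> unjoined_edges n 0 \<omega>}" by (auto simp: A_def)
    then show ?thesis using unjoined_edge_measurable[OF that] by auto
  qed
  define X where "X \<omega> = (\<Sum>e\<in>?E. indicat_real (A e) \<omega>)" for \<omega>
  have int: "integrable ?M X" unfolding X_def[abs_def] 
    using A by (intro Bochner_Integration.integrable_sum integrable_real_indicator) (auto simp: emeasure_eq_measure)
  have nonneg: "0 \<le> X \<omega>" for \<omega> by (simp add: X_def sum_nonneg)
  have "expectation X = (\<Sum>e\<in>?E. prob (A e))"
    unfolding X_def[abs_def] using A
    by (subst Bochner_Integration.integral_sum) (auto intro!: integrable_real_indicator simp: emeasure_eq_measure)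
  also have "\<dots> \<le> (\<Sum>e\<in>?E. \<delta>)"
    unfolding A_def using \<delta> by (intro sum_mono prob_newly_unjoined_le)
  also have "\<dots> = n * (real n - 1) / 2 * \<delta>" by (simp add: card_complete_edges)
  also have "\<dots> \<le> real n * n * \<delta>"
    using \<delta> by (intro mult_right_mono) (auto simp: field_simps)
  finally have EX: "expectation X \<le> real n * n * \<delta>" .
  define B where "B = {\<omega> \<in> space ?M. X \<omega> \<ge> \<eta> * n}"
  have B: "B \<in> events" unfolding B_def using borel_measurable_integrable[OF int] by measurable
  have "prob B \<le> expectation X / (\<eta> * n)"
    unfolding B_def using int n \<eta>
    by (intro integral_Markov_inequality_measure[where A = "{}"]) (auto simp: nonneg)
  also have "\<dots> \<le> real n * n * \<delta> / (\<eta> * n)" using EX n \<eta> by (intro divide_right_mono) auto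
  also have "\<dots> = n * \<delta> / \<eta>" using n by simp
  finally have pB: "prob B \<le> n * \<delta> / \<eta>" .
  define G where "G = {\<omega> \<in> space ?M. \<bar>expected_overlap n b \<omega> / n - 1\<bar> \<le> 3 * \<eta>}"
  have G: "G \<in> events"
  proof -
    note measurable_expected_overlap[of n b, measurable]
    show ?thesis unfolding G_def by measurable
  qed
  have "space ?M - B \<subseteq> G"
  proof
    fix \<omega> assume \<omega>: "\<omega> \<in> space ?M - B"
    have "X \<omega> = real (card (unjoined_edges n \<delta> \<omega> - unjoined_edges n 0 \<omega>))"
    proof -
      have "X \<omega> = (\<Sum>e\<in>?E. of_bool (e \<in> unjoined_edges n \<delta> \<omega> - unjoined_edges n 0 \<omega>))"
        unfolding X_def using \<omega> by (intro sum.cong) (auto simp: A_def)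
      also have "\<dots> = real (card (?E \<inter> (unjoined_edges n \<delta> \<omega> - unjoined_edges n 0 \<omega>)))"
        by (simp add: finite_complete_edges Int_def)
      also have "?E \<inter> (unjoined_edges n \<delta> \<omega> - unjoined_edges n 0 \<omega>) =
          unjoined_edges n \<delta> \<omega> - unjoined_edges n 0 \<omega>" by (auto simp: unjoined_edges_def)
      finally show ?thesis .
    qed
    then have "card (unjoined_edges n \<delta> \<omega> - unjoined_edges n 0 \<omega>) < \<eta> * n"
      using \<omega> by (auto simp: B_def)
    moreover have "card (unjoined_edges n \<delta> \<omega>) \<le>
        card (unjoined_edges n 0 \<omega> \<union> (unjoined_edges n \<delta> \<omega> - unjoined_edges n 0 \<omega>))"
      by (intro card_mono) (auto simp: finite_unjoined_edges)
    then have "card (unjoined_edges n \<delta> \<omega>) \<le>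
        card (unjoined_edges n 0 \<omega>) + card (unjoined_edges n \<delta> \<omega> - unjoined_edges n 0 \<omega>)"
      using card_Un_le order_trans by blast
    moreover have "card (unjoined_edges n 0 \<omega>) \<le> n" using card_unjoined_edges_0[OF n, of \<omega>] by linarith
    ultimately have "card (unjoined_edges n \<delta> \<omega>) \<le> (1 + \<eta>) * n" by (simp add: algebra_simps)
    then have "\<bar>expected_overlap n b \<omega> / n - 1\<bar> \<le> 3 * \<eta>" by (rule overlap_near_n[OF b n \<eta> \<delta>(2)])
    then show "\<omega> \<in> G" using \<omega> by (simp add: G_def)
  qed
  then have "prob (space ?M - B) \<le> prob G" using G by (rule finite_measure_mono)
  then have "1 - prob B \<le> prob G" using prob_compl[OF B] by simp
  with pB show ?thesis by (simp add: G_def)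
qed

text \<open>The choice \<open>\<delta> = 6 * ln n / \<beta> n\<close> makes \<open>n ^ 6 * exp (- (\<beta> n * \<delta>))\<close> equal to one, and \<open>n * \<delta>\<close> tends to
  zero as soon as \<open>\<beta>\<close> is of larger order than \<open>n * ln n\<close>.\<close>

lemma overlap_low_temperature:
  fixes \<beta> :: "nat \<Rightarrow> real"
  assumes nonneg: "\<And>n. 0 \<le> \<beta> n" and large: "(\<lambda>n. real n * ln (real n)) \<in> o(\<beta>)"
  shows "whp_asymp (\<lambda>n \<omega>. expected_overlap n (\<beta> n) \<omega>) (\<lambda>n. real n)"
proof (rule whp_asympI)
  fix \<epsilon> :: real assume \<epsilon>: "0 < \<epsilon>"
  define \<eta> where "\<eta> = min (1 / 3) (\<epsilon> / 3)"
  have \<eta>: "0 < \<eta>" "\<eta> \<le> 1 / 3" "3 * \<eta> \<le> \<epsilon>" using \<epsilon> by (auto simp: \<eta>_def)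
  let ?p = "\<lambda>n. measure (env_measure n) {\<omega> \<in> space (env_measure n).
      \<bar>expected_overlap n (\<beta> n) \<omega> / real n - 1\<bar> \<le> \<epsilon>}"
  define \<rho> where "\<rho> n = n * (6 * ln (real n) / \<beta> n) / \<eta>" for n
  have lim: "(\<lambda>n. real n * ln (real n) / \<beta> n) \<longlonglongrightarrow> 0" by (rule smalloD_tendsto[OF large])
  have "(\<lambda>n. 1 - 6 / \<eta> * (real n * ln (real n) / \<beta> n)) \<longlonglongrightarrow> 1 - 6 / \<eta> * 0"
    by (intro tendsto_intros lim)
  then have \<rho>: "(\<lambda>n. 1 - \<rho> n) \<longlonglongrightarrow> 1" by (simp add: \<rho>_def mult_ac)
  have "eventually (\<lambda>n. norm (real n * ln (real n)) \<le> 1 * norm (\<beta> n)) sequentially"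
    by (rule landau_o.smallD[OF large]) simp
  moreover have "eventually (\<lambda>n. n \<ge> (2::nat)) sequentially" by (rule eventually_ge_at_top)
  moreover have "eventually (\<lambda>n. 2 / \<eta> \<le> real n) sequentially" by real_asymp
  ultimately have lower: "eventually (\<lambda>n. 1 - \<rho> n \<le> ?p n) sequentially"
  proof eventually_elim
    case (elim n)
    interpret prob_space "env_measure n" by (rule prob_space_env_measure)
    have "0 < real n * ln (real n)" using elim(2) by simp
    then have b: "0 < \<beta> n" using elim(1) nonneg[of n] by auto
    have "exp (- (\<beta> n * (6 * ln (real n) / \<beta> n))) = exp (ln (real n)) powi (- 6)"
      using b by (simp add: exp_minus exp_of_nat_mult[symmetric] power_int_minus)
    then have "real n ^ 6 * exp (- (\<beta> n * (6 * ln (real n) / \<beta> n))) = 1"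
      using elim(2) by (simp add: power_int_minus)
    then have "1 - \<rho> n \<le> prob {\<omega> \<in> space (env_measure n).
        \<bar>expected_overlap n (\<beta> n) \<omega> / real n - 1\<bar> \<le> 3 * \<eta>}"
      unfolding \<rho>_def using b elim \<eta>
      by (intro low_temperature_prob) (auto simp: field_simps)
    also have "\<dots> \<le> ?p n"
    proof (rule finite_measure_mono)
      note measurable_expected_overlap[of n "\<beta> n", measurable]
      show "{\<omega> \<in> space (env_measure n). \<bar>expected_overlap n (\<beta> n) \<omega> / real n - 1\<bar> \<le> \<epsilon>} \<in> events"
        by measurable
    qed (use \<eta>(3) in auto)
    finally show ?case .
  qed
  show "?p \<longlonglongrightarrow> 1"
  proof (rule tendsto_sandwich[OF lower _ \<rho>])
    show "eventually (\<lambda>n. ?p n \<le> 1) sequentially"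
      using prob_space.prob_le_1[OF prob_space_env_measure] by (intro always_eventually) blast
  qed auto
qed

section \<open>The two regimes of the overlap\<close>

theorem theorem4p1p2:
  fixes \<beta> :: "nat \<Rightarrow> real"
  assumes "\<And>n. 0 \<le> \<beta> n"
  shows "((\<forall>n. 0 < \<beta> n) \<and> \<beta> \<in> o(\<lambda>n. real n / ln (real n)) \<longrightarrow>
            whp_asymp (\<lambda>n \<omega>. expected_overlap n (\<beta> n) \<omega>)
              (\<lambda>n. \<beta> n * ((1 - exp (- 2 * \<beta> n)) / (1 - exp (- \<beta> n))\<^sup>2))) \<and>
         ((\<lambda>n. real n * (ln (real n))\<^sup>2) \<in> o(\<beta>) \<longrightarrow>
            whp_asymp (\<lambda>n \<omega>. expected_overlap n (\<beta> n) \<omega>) (\<lambda>n. real n))"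
proof (intro conjI impI)
  assume "(\<forall>n. 0 < \<beta> n) \<and> \<beta> \<in> o(\<lambda>n. real n / ln (real n))"
  then show "whp_asymp (\<lambda>n \<omega>. expected_overlap n (\<beta> n) \<omega>)
      (\<lambda>n. \<beta> n * ((1 - exp (- 2 * \<beta> n)) / (1 - exp (- \<beta> n))\<^sup>2))"
    by (intro overlap_high_temperature) auto
next
  assume large: "(\<lambda>n. real n * (ln (real n))\<^sup>2) \<in> o(\<beta>)"
  have "(\<lambda>n. real n * ln (real n)) \<in> O(\<lambda>n. real n * (ln (real n))\<^sup>2)" by real_asymp
  then have "(\<lambda>n. real n * ln (real n)) \<in> o(\<beta>)" using large by (rule landau_o.big_small_trans)
  with assms show "whp_asymp (\<lambda>n \<omega>. expected_overlap n (\<beta> n) \<omega>) (\<lambda>n. real n)"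
    by (rule overlap_low_temperature)
qed

end
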